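(* Let $l\ge2$ and let $L_{rel}$, $\mathbf{C}_n$ and the probability measure $\delta_n^{\mathbf{C}}$ on $\mathbf{C}_n$ be as in the context. For every $l$-colour compatible extension axiom $\varphi$, $\lim_{n\to\infty}\delta_n^{\mathbf{C}}(\varphi)=1$, where $\delta_n^{\mathbf{C}}(\varphi)=\delta_n^{\mathbf{C}}(\{\mathcal{M}\in\mathbf{C}_n:\mathcal{M}\models\varphi\})$.
   Context: $l\ge2$ is a fixed integer. $L_{rel}$ is a first-order language with finite nonempty relational vocabulary, all symbols of arity at least $2$. $L$ has in addition new unary relation symbols $P_1,\ldots,P_l$; an element has colour $i$ if it satisfies $P_i$. $\mathbf{K}_n$ is the set of all $L$-structures $\mathcal{M}$ with universe $\{1,\ldots,n\}$ such that every element has exactly one colour and whenever $R$ is a relation symbol of $L_{rel}$ and $\mathcal{M}\models R(a_1,\ldots,a_m)$, at least two of the $a_i$ have different colours. $\mathbf{C}_n=\{\mathcal{M}\upharpoonright L_{rel}:\mathcal{M}\in\mathbf{K}_n\}$. An $l$-colouring of an $L_{rel}$-structure $\mathcal{M}$ is a function $\gamma:M\to\{1,\ldots,l\}$ such that no tuple in any $R^{\mathcal{M}}$ has all its entries of the same colour; $\mathcal{M}$ is $l$-colourable if it has one (similarly with $l-1$). Measure: for $\mathcal{M}\in\mathbf{K}_n$ and $d\in\mathbb{N}$, $\mathcal{M}\upharpoonright d$ is the $L$-structure with the same universe in which $\bar a\in R^{\mathcal{M}\upharpoonright d}$ iff $\bar a\in R^{\mathcal{M}}$ and at most $d$ distinct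 elements occur in $\bar a$, for each relation symbol $R$ of $L$. $\mathbf{K}_n\upharpoonright d=\{\mathcal{M}\upharpoonright d:\mathcal{M}\in\mathbf{K}_n\}$. $\mathbb{P}_{n,0}$ is uniform on $\mathbf{K}_n\upharpoonright0$ and, for $\mathcal{B}\in\mathbf{K}_n\upharpoonright(r+1)$, $\mathbb{P}_{n,r+1}(\mathcal{B})=\mathbb{P}_{n,r}(\mathcal{B}\upharpoonright r)\big/\big|\{\mathcal{B}'\in\mathbf{K}_n\upharpoonright(r+1):\mathcal{B}'\upharpoonright r=\mathcal{B}\upharpoonright r\}\big|$. $\delta^{\mathbf{K}}_n=\mathbb{P}_{n,\rho}$ with $\rho$ the largest arity of a relation symbol. For $\mathbf{Y}\subseteq\mathbf{C}_n$, $\delta_n^{\mathbf{C}}(\mathbf{Y})=\delta_n^{\mathbf{K}}(\{\mathcal{M}\in\mathbf{K}_n:\mathcal{M}\upharpoonright L_{rel}\in\mathbf{Y}\})$. $l$-colour compatible extension axioms: Fix an $l$-colourable $L_{rel}$-structure $\mathcal{S}$ with universe $\{1,\ldots,s\}$, $s\ge3$, such that every $l$-colouring of $\mathcal{S}$ gives $s-1$ and $s$ the same colour, and for every colour $i$ there is an $l$-colouring of $\mathcal{S}$ giving both $s-1$ and $s$ the colour $i$ (such $\mathcal{S}$ exists). For a finite structure $\mathcal{D}$ with universe $\{1,\ldots,d\}$, $\chi_{\mathcal{D}}(x_1,\ldots,x_d)$ is a quantifier-free $L_{rel}$-formula such that $\mathcal{M}\models\chi_{\mathcal{D}}(a_1,\ldots,a_d)$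 iff $a_i\mapsto i$ is an isomorphism from $\mathcal{M}\upharpoonright\{a_1,\ldots,a_d\}$ to $\mathcal{D}$. Let $\xi(y,z)$ be $y=z\vee\exists u_1,\ldots,u_{s-2}\,\chi_{\mathcal{S}}(u_1,\ldots,u_{s-2},y,z)$. Fix an $l$-colourable but not $(l-1)$-colourable $L_{rel}$-structure $\mathcal{U}$ with universe $\{1,\ldots,u\}$ such that $l$ divides $u$ and every partition of the universe into $l$ parts of equal size gives an $l$-colouring of $\mathcal{U}$ (such $\mathcal{U}$ exists), and fix an $l$-colouring of $\mathcal{U}$ in which $1,\ldots,l$ have different colours. Let $I$ be the set of unordered pairs $\{i,j\}\subseteq\{1,\ldots,u\}$ with $i,j$ of the same colour in it, and let $\zeta(x_1,\ldots,x_u)$ be $\chi_{\mathcal{U}}(x_1,\ldots,x_u)\wedge\bigwedge_{\{i,j\}\in I}\xi(x_i,x_j)\wedge\bigwedge_{\{i,j\}\notin I}\neg\xi(x_i,x_j)$. Let $\mathcal{B}$ be a finite $l$-colourable $L_{rel}$-structure and $\mathcal{A}$ a proper substructure, with $A=\{1,\ldots,\alpha\}$, $B=\{1,\ldots,\beta\}$. For an $l$-colouring $\gamma'$ of $\mathcal{B}$ with restriction $\gamma=\gamma'\upharpoonright A$, and a permutation $\tau$ of $\{1,\ldots,l\}$, let $\theta_{\gamma,\tau}(x_1,\ldots,x_l,y_1,\ldots,y_\alpha)=\bigwedge_{j=1}^{\alpha}\xi(x_{\tau(\gamma(j))},y_j)$ and $\theta_{\gamma',\tau}(x_1,\ldots,x_l,y_1,\ldots,y_\beta)=\bigwedge_{j=1}^{\beta}\xi(x_{\tau(\gamma'(j))},y_j)$.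 The corresponding instance is the sentence $$\forall x_1,\ldots,x_u,y_1,\ldots,y_\alpha\,\exists y_{\alpha+1},\ldots,y_\beta\big([\zeta(\bar x)\wedge\chi_{\mathcal{A}}(y_1,\ldots,y_\alpha)\wedge\theta_{\gamma,\tau}]\to[\chi_{\mathcal{B}}(y_1,\ldots,y_\beta)\wedge\theta_{\gamma',\tau}]\big)$$ (if $A=\emptyset$, the conjuncts $\chi_{\mathcal{A}},\theta_{\gamma,\tau}$ are omitted). The $l$-colour compatible $\mathcal{B}/\mathcal{A}$-extension axiom is the conjunction of all its (finitely many) instances over all $\gamma',\tau$. *)

theory Defs
  imports Complex_Main "HOL-Library.FuncSet" "HOL-Combinatorics.Permutations"
begin

section \<open>Relational languages and structures\<close>

record 's lang =
  syms :: "'s set"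
  arity :: "'s \<Rightarrow> nat"

record ('s, 'a) struct =
  univ :: "'a set"
  intp :: "'s \<Rightarrow> 'a list set"

text \<open>Symbols outside the language are interpreted by the empty relation, so that structures
  over a finite language with a given finite universe form a finite set and can be counted.\<close>

definition is_struct :: "'s lang \<Rightarrow> ('s, 'a) struct \<Rightarrow> bool" where
  "is_struct L M \<longleftrightarrow>
     (\<forall>R\<in>syms L. \<forall>as\<in>intp M R. length as = arity L R \<and> set as \<subseteq> univ M) \<and>
     (\<forall>R. R \<notin> syms L \<longrightarrow> intp M R = {})"

definition substr :: "('s, 'a) struct \<Rightarrow> 'a set \<Rightarrow> ('s, 'a) struct" where
  "substr M X = \<lparr>univ = X, intp = (\<lambda>R. {as \<in> intp M R. set as \<subseteq> X})\<rparr>"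

definition proper_substructure :: "('s, 'a) struct \<Rightarrow> ('s, 'a) struct \<Rightarrow> bool" where
  "proper_substructure A B \<longleftrightarrow> univ A \<subset> univ B \<and> A = substr B (univ A)"

definition is_iso ::
  "'s lang \<Rightarrow> ('a \<Rightarrow> 'b) \<Rightarrow> ('s, 'a) struct \<Rightarrow> ('s, 'b) struct \<Rightarrow> bool" where
  "is_iso L f M N \<longleftrightarrow> bij_betw f (univ M) (univ N) \<and>
     (\<forall>R\<in>syms L. \<forall>as. set as \<subseteq> univ M \<and> length as = arity L R \<longrightarrow>
        (as \<in> intp M R \<longleftrightarrow> map f as \<in> intp N R))"


section \<open>First-order formulas\<close>

datatype ('s, 'v) fm =
    TT
  | Eq 'v 'v
  | Atom 's "'v list"
  | Neg "('s, 'v) fm"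
  | And "('s, 'v) fm" "('s, 'v) fm"
  | Exists 'v "('s, 'v) fm"

definition Or :: "('s, 'v) fm \<Rightarrow> ('s, 'v) fm \<Rightarrow> ('s, 'v) fm" where
  "Or p q = Neg (And (Neg p) (Neg q))"

definition Imp :: "('s, 'v) fm \<Rightarrow> ('s, 'v) fm \<Rightarrow> ('s, 'v) fm" where
  "Imp p q = Neg (And p (Neg q))"

definition Forall :: "'v \<Rightarrow> ('s, 'v) fm \<Rightarrow> ('s, 'v) fm" where
  "Forall x p = Neg (Exists x (Neg p))"

abbreviation Exs :: "'v list \<Rightarrow> ('s, 'v) fm \<Rightarrow> ('s, 'v) fm" where
  "Exs xs p \<equiv> foldr Exists xs p"

abbreviation Alls :: "'v list \<Rightarrow> ('s, 'v) fm \<Rightarrow> ('s, 'v) fm" where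
  "Alls xs p \<equiv> foldr Forall xs p"

text \<open>Conjunction over a finite index set, taken in some arbitrary but fixed order.\<close>

definition Conj :: "'i set \<Rightarrow> ('i \<Rightarrow> ('s, 'v) fm) \<Rightarrow> ('s, 'v) fm" where
  "Conj I p = foldr And (map p (SOME xs. set xs = I \<and> distinct xs)) TT"

primrec sat :: "('s, 'a) struct \<Rightarrow> ('v \<Rightarrow> 'a) \<Rightarrow> ('s, 'v) fm \<Rightarrow> bool" where
  "sat M e TT \<longleftrightarrow> True"
| "sat M e (Eq x y) \<longleftrightarrow> e x = e y"
| "sat M e (Atom R xs) \<longleftrightarrow> map e xs \<in> intp M R"
| "sat M e (Neg p) \<longleftrightarrow> \<not> sat M e p"
| "sat M e (And p q) \<longleftrightarrow> sat M e p \<and> sat M e q"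
| "sat M e (Exists x p) \<longleftrightarrow> (\<exists>a\<in>univ M. sat M (e(x := a)) p)"

definition models :: "('s, 'a) struct \<Rightarrow> ('s, 'v) fm \<Rightarrow> bool" where
  "models M p \<longleftrightarrow> (\<forall>e. range e \<subseteq> univ M \<longrightarrow> sat M e p)"

lemma sat_derived [simp]:
  "sat M e (Or p q) \<longleftrightarrow> sat M e p \<or> sat M e q"
  "sat M e (Imp p q) \<longleftrightarrow> (sat M e p \<longrightarrow> sat M e q)"
  "sat M e (Forall x p) \<longleftrightarrow> (\<forall>a\<in>univ M. sat M (e(x := a)) p)"
  by (auto simp: Or_def Imp_def Forall_def)

lemma sat_Conj [simp]:
  assumes "finite I"
  shows "sat M e (Conj I p) \<longleftrightarrow> (\<forall>i\<in>I. sat M e (p i))"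
proof -
  have fold: "sat M e (foldr And (map p xs) TT) \<longleftrightarrow> (\<forall>i\<in>set xs. sat M e (p i))" for xs
    by (induction xs) auto
  have "\<exists>xs. set xs = I \<and> distinct xs"
    using assms by (rule finite_distinct_list)
  then have "set (SOME xs. set xs = I \<and> distinct xs) = I"
    by (rule someI2_ex) blast
  then show ?thesis
    unfolding Conj_def fold by simp
qed


section \<open>Colourings and coloured structures\<close>

text \<open>Colourings are extensional functions, so a structure has only finitely many of them.\<close>

definition colourings :: "nat \<Rightarrow> 's lang \<Rightarrow> ('s, 'a) struct \<Rightarrow> ('a \<Rightarrow> nat) set" where
  "colourings l L M = {\<gamma> \<in> univ M \<rightarrow>\<^sub>E {1..l}.
     \<forall>R\<in>syms L. \<forall>as\<in>intp M R. \<not> (\<exists>c. \<forall>a\<in>set as. \<gamma> a = c)}"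

definition colourable :: "nat \<Rightarrow> 's lang \<Rightarrow> ('s, 'a) struct \<Rightarrow> bool" where
  "colourable l L M \<longleftrightarrow> colourings l L M \<noteq> {}"

datatype 'r csym = Rel 'r | Col nat

definition col_lang :: "nat \<Rightarrow> 'r lang \<Rightarrow> 'r csym lang" where
  "col_lang l L = \<lparr>syms = Rel ` syms L \<union> Col ` {1..l},
     arity = (\<lambda>R. case R of Rel R' \<Rightarrow> arity L R' | Col i \<Rightarrow> 1)\<rparr>"

definition reduct :: "('r csym, 'a) struct \<Rightarrow> ('r, 'a) struct" where
  "reduct M = \<lparr>univ = univ M, intp = (\<lambda>R. intp M (Rel R))\<rparr>"

definition KK :: "nat \<Rightarrow> 'r lang \<Rightarrow> nat \<Rightarrow> ('r csym, nat) struct set" where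
  "KK l L n = {M. is_struct (col_lang l L) M \<and> univ M = {1..n} \<and>
     (\<forall>a\<in>univ M. \<exists>!i. i \<in> {1..l} \<and> [a] \<in> intp M (Col i)) \<and>
     (\<forall>R\<in>syms L. \<forall>as\<in>intp M (Rel R). \<exists>a\<in>set as. \<exists>b\<in>set as. \<exists>i\<in>{1..l}. \<exists>j\<in>{1..l}.
        i \<noteq> j \<and> [a] \<in> intp M (Col i) \<and> [b] \<in> intp M (Col j))}"

definition CC :: "nat \<Rightarrow> 'r lang \<Rightarrow> nat \<Rightarrow> ('r, nat) struct set" where
  "CC l L n = reduct ` KK l L n"


section \<open>The measures\<close>

definition trunc :: "nat \<Rightarrow> ('s, 'a) struct \<Rightarrow> ('s, 'a) struct" where
  "trunc d M = \<lparr>univ = univ M, intp = (\<lambda>R. {as \<in> intp M R. card (set as) \<le> d})\<rparr>"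

definition Ktrunc :: "nat \<Rightarrow> 'r lang \<Rightarrow> nat \<Rightarrow> nat \<Rightarrow> ('r csym, nat) struct set" where
  "Ktrunc l L n d = trunc d ` KK l L n"

text \<open>The point mass at \<open>B\<close> of the measure on \<open>Ktrunc l L n r\<close>; only meaningful for
  \<open>B \<in> Ktrunc l L n r\<close>.\<close>

primrec mass :: "nat \<Rightarrow> 'r lang \<Rightarrow> nat \<Rightarrow> nat \<Rightarrow> ('r csym, nat) struct \<Rightarrow> real" where
  "mass l L n 0 B = 1 / card (Ktrunc l L n 0)"
| "mass l L n (Suc r) B =
     mass l L n r (trunc r B) / card {B' \<in> Ktrunc l L n (Suc r). trunc r B' = trunc r B}"

definition max_arity :: "'s lang \<Rightarrow> nat" where
  "max_arity L = Max (arity L ` syms L)"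

text \<open>No tuple has more than \<open>max_arity\<close> distinct entries, so truncation at that level does
  nothing, and the top-level measure lives on \<open>KK l L n\<close> itself.\<close>

definition \<delta>K :: "nat \<Rightarrow> 'r lang \<Rightarrow> nat \<Rightarrow> ('r csym, nat) struct set \<Rightarrow> real" where
  "\<delta>K l L n Y = (\<Sum>M\<in>Y. mass l L n (max_arity (col_lang l L)) M)"

definition \<delta>C :: "nat \<Rightarrow> 'r lang \<Rightarrow> nat \<Rightarrow> ('r, nat) struct set \<Rightarrow> real" where
  "\<delta>C l L n Y = \<delta>K l L n {M \<in> KK l L n. reduct M \<in> Y}"


section \<open>Colour compatible extension axioms\<close>

text \<open>\<open>Wv\<close> is reserved for the variables bound inside \<open>xi\<close>, so no capture can occur when
  \<open>xi\<close> is applied to \<open>Xv\<close>- and \<open>Yv\<close>-variables.\<close>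

datatype var = Xv nat | Yv nat | Wv nat

text \<open>\<open>chi L D v\<close> describes \<open>D\<close> up to isomorphism, the variable \<open>v i\<close> standing for the
  element \<open>i\<close> of \<open>D\<close>.\<close>

definition chi :: "'r lang \<Rightarrow> ('r, nat) struct \<Rightarrow> (nat \<Rightarrow> 'v) \<Rightarrow> ('r, 'v) fm" where
  "chi L D v = And
     (Conj {(i, j). i \<in> univ D \<and> j \<in> univ D \<and> i \<noteq> j} (\<lambda>(i, j). Neg (Eq (v i) (v j))))
     (Conj (SIGMA R : syms L. {is. set is \<subseteq> univ D \<and> length is = arity L R})
        (\<lambda>(R, is). if is \<in> intp D R then Atom R (map v is) else Neg (Atom R (map v is))))"

lemma sat_chi_iff:
  assumes "finite (syms L)" and fin: "finite (univ D)"
  shows "sat M e (chi L D v) \<longleftrightarrow> inj_on (\<lambda>i. e (v i)) (univ D) \<and>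
    (\<forall>R\<in>syms L. \<forall>is. set is \<subseteq> univ D \<and> length is = arity L R \<longrightarrow>
       (map (\<lambda>i. e (v i)) is \<in> intp M R \<longleftrightarrow> is \<in> intp D R))"
proof -
  have 1: "finite {(i, j). i \<in> univ D \<and> j \<in> univ D \<and> i \<noteq> j}"
    by (rule finite_subset[of _ "univ D \<times> univ D"]) (use fin in auto)
  have 2: "finite (SIGMA R : syms L. {is. set is \<subseteq> univ D \<and> length is = arity L R})"
    using assms by (intro finite_SigmaI finite_lists_length_eq)
  have 3: "map e (map v is) = map (\<lambda>i. e (v i)) is" for "is"
    by simp
  show ?thesis
    unfolding chi_def sat.simps sat_Conj[OF 1] sat_Conj[OF 2] inj_on_def
    by (auto simp: comp_def split: if_splits)
qed

text \<open>If the \<open>v i\<close> are assigned elements \<open>a\<^sub>i\<close> of \<open>M\<close>, then \<open>chi L D v\<close> says that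
  \<open>a\<^sub>i \<mapsto> i\<close> is a (well-defined) isomorphism from the substructure on the \<open>a\<^sub>i\<close> onto \<open>D\<close>.\<close>

lemma sat_chi_iff_iso:
  assumes "finite (syms L)" and "finite (univ D)"
  shows "sat M e (chi L D v) \<longleftrightarrow>
    (\<exists>f. (\<forall>i\<in>univ D. f (e (v i)) = i) \<and>
         is_iso L f (substr M ((\<lambda>i. e (v i)) ` univ D)) D)"
    (is "_ \<longleftrightarrow> (\<exists>f. _ \<and> is_iso L f (substr M (?a ` univ D)) D)")
proof
  assume "sat M e (chi L D v)"
  then have inj: "inj_on ?a (univ D)" and
    rel: "\<And>R is. R \<in> syms L \<Longrightarrow> set is \<subseteq> univ D \<Longrightarrow> length is = arity L R \<Longrightarrow>
       map ?a is \<in> intp M R \<longleftrightarrow> is \<in> intp D R"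
    using sat_chi_iff[OF assms] by blast+
  define f where "f = the_inv_into (univ D) ?a"
  have f: "f (e (v i)) = i" if "i \<in> univ D" for i
    unfolding f_def using the_inv_into_f_f[OF inj that] .
  have af: "e (v (f a)) = a" "f a \<in> univ D" if "a \<in> ?a ` univ D" for a
    using that f by auto
  have "is_iso L f (substr M (?a ` univ D)) D"
    unfolding is_iso_def substr_def
  proof (intro conjI ballI allI impI)
    show "bij_betw f (univ \<lparr>univ = ?a ` univ D, intp = \<lambda>R. {as \<in> intp M R. set as \<subseteq> ?a ` univ D}\<rparr>)
      (univ D)"
      unfolding bij_betw_def f_def
      using the_inv_into_onto[OF inj] inj_on_the_inv_into[OF inj] by simp
  next
    fix R as
    assume R: "R \<in> syms L" and as:
      "set as \<subseteq> univ \<lparr>univ = ?a ` univ D, intp = \<lambda>R. {as \<in> intp M R. set as \<subseteq> ?a ` univ D}\<rparr>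
       \<and> length as = arity L R"
    have "map ?a (map f as) = as"
      using as af(1) by (auto simp: map_idI subset_iff)
    moreover have "set (map f as) \<subseteq> univ D" "length (map f as) = arity L R"
      using as af(2) by auto
    ultimately show
      "as \<in> intp \<lparr>univ = ?a ` univ D, intp = \<lambda>R. {as \<in> intp M R. set as \<subseteq> ?a ` univ D}\<rparr> R
       \<longleftrightarrow> map f as \<in> intp D R"
      using rel[OF R, of "map f as"] as by simp
  qed
  then show "\<exists>f. (\<forall>i\<in>univ D. f (e (v i)) = i) \<and> is_iso L f (substr M (?a ` univ D)) D"
    using f by blast
next
  assume "\<exists>f. (\<forall>i\<in>univ D. f (e (v i)) = i) \<and> is_iso L f (substr M (?a ` univ D)) D"
  then obtain f where f: "\<And>i. i \<in> univ D \<Longrightarrow> f (e (v i)) = i"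
    and iso: "is_iso L f (substr M (?a ` univ D)) D" by blast
  have "inj_on ?a (univ D)"
    by (rule inj_on_inverseI[of _ f]) (rule f)
  moreover have "map ?a is \<in> intp M R \<longleftrightarrow> is \<in> intp D R"
    if "R \<in> syms L" "set is \<subseteq> univ D" "length is = arity L R" for R "is"
  proof -
    have "map f (map ?a is) = is"
      using that(2) f by (auto simp: map_idI subset_iff)
    then show ?thesis
      using iso that unfolding is_iso_def substr_def
      by (auto dest!: bspec[OF _ that(1)] spec[of _ "map ?a is"] simp: image_subset_iff subset_iff)
  qed
  ultimately show "sat M e (chi L D v)"
    using sat_chi_iff[OF assms] by blast
qed

definition xi :: "'r lang \<Rightarrow> ('r, nat) struct \<Rightarrow> var \<Rightarrow> var \<Rightarrow> ('r, var) fm" where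
  "xi L S y z = (let s = card (univ S) in
     Or (Eq y z)
        (Exs (map Wv [1..<s - 1])
           (chi L S (\<lambda>i. if i = s - 1 then y else if i = s then z else Wv i))))"

definition same_colour_structure :: "nat \<Rightarrow> 'r lang \<Rightarrow> ('r, nat) struct \<Rightarrow> bool" where
  "same_colour_structure l L S \<longleftrightarrow> is_struct L S \<and> colourable l L S \<and>
     (\<exists>s\<ge>3. univ S = {1..s} \<and>
        (\<forall>\<gamma>\<in>colourings l L S. \<gamma> (s - 1) = \<gamma> s) \<and>
        (\<forall>i\<in>{1..l}. \<exists>\<gamma>\<in>colourings l L S. \<gamma> (s - 1) = i \<and> \<gamma> s = i))"

text \<open>A partition into \<open>l\<close> parts is given by its labelling \<open>\<gamma>\<close> with part numbers.\<close>

definition balanced_structure :: "nat \<Rightarrow> 'r lang \<Rightarrow> ('r, nat) struct \<Rightarrow> bool" where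
  "balanced_structure l L U \<longleftrightarrow> is_struct L U \<and> colourable l L U \<and> \<not> colourable (l - 1) L U \<and>
     (\<exists>u. univ U = {1..u} \<and> l dvd u \<and>
        (\<forall>\<gamma> \<in> {1..u} \<rightarrow>\<^sub>E {1..l}.
           (\<forall>i\<in>{1..l}. \<forall>j\<in>{1..l}. card {a \<in> {1..u}. \<gamma> a = i} = card {a \<in> {1..u}. \<gamma> a = j})
           \<longrightarrow> \<gamma> \<in> colourings l L U))"

definition zeta ::
  "'r lang \<Rightarrow> ('r, nat) struct \<Rightarrow> ('r, nat) struct \<Rightarrow> (nat \<Rightarrow> nat) \<Rightarrow> ('r, var) fm" where
  "zeta L S U c = And (chi L U Xv) (And
     (Conj {(i, j). i \<in> univ U \<and> j \<in> univ U \<and> i < j \<and> c i = c j} (\<lambda>(i, j). xi L S (Xv i) (Xv j)))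
     (Conj {(i, j). i \<in> univ U \<and> j \<in> univ U \<and> i < j \<and> c i \<noteq> c j}
        (\<lambda>(i, j). Neg (xi L S (Xv i) (Xv j)))))"

definition theta ::
  "'r lang \<Rightarrow> ('r, nat) struct \<Rightarrow> nat set \<Rightarrow> (nat \<Rightarrow> nat) \<Rightarrow> (nat \<Rightarrow> nat) \<Rightarrow> ('r, var) fm" where
  "theta L S J \<gamma> \<tau> = Conj J (\<lambda>j. xi L S (Xv (\<tau> (\<gamma> j))) (Yv j))"

text \<open>For empty \<open>A\<close>, the conjuncts \<open>chi L A Yv\<close> and \<open>theta\<close> over \<open>univ A\<close> are empty conjunctions
  (all arities being positive), which amounts to omitting them.\<close>

definition ext_instance ::
  "'r lang \<Rightarrow> ('r, nat) struct \<Rightarrow> ('r, nat) struct \<Rightarrow> (nat \<Rightarrow> nat) \<Rightarrow>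
   ('r, nat) struct \<Rightarrow> ('r, nat) struct \<Rightarrow> (nat \<Rightarrow> nat) \<Rightarrow> (nat \<Rightarrow> nat) \<Rightarrow> ('r, var) fm" where
  "ext_instance L S U c A B \<gamma>' \<tau> =
    (let u = card (univ U); \<alpha> = card (univ A); \<beta> = card (univ B); \<gamma> = restrict \<gamma>' (univ A) in
     Alls (map Xv [1..<u + 1] @ map Yv [1..<\<alpha> + 1]) (Exs (map Yv [\<alpha> + 1..<\<beta> + 1])
       (Imp (And (zeta L S U c) (And (chi L A Yv) (theta L S (univ A) \<gamma> \<tau>)))
            (And (chi L B Yv) (theta L S (univ B) \<gamma>' \<tau>)))))"

definition ext_axiom ::
  "nat \<Rightarrow> 'r lang \<Rightarrow> ('r, nat) struct \<Rightarrow> ('r, nat) struct \<Rightarrow> (nat \<Rightarrow> nat) \<Rightarrow>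
   ('r, nat) struct \<Rightarrow> ('r, nat) struct \<Rightarrow> ('r, var) fm" where
  "ext_axiom l L S U c A B =
     Conj (colourings l L B \<times> {\<tau>. \<tau> permutes {1..l}}) (\<lambda>(\<gamma>', \<tau>). ext_instance L S U c A B \<gamma>' \<tau>)"

definition is_ext_axiom ::
  "nat \<Rightarrow> 'r lang \<Rightarrow> ('r, nat) struct \<Rightarrow> ('r, nat) struct \<Rightarrow> (nat \<Rightarrow> nat) \<Rightarrow> ('r, var) fm \<Rightarrow> bool" where
  "is_ext_axiom l L S U c \<phi> \<longleftrightarrow> (\<exists>A B \<alpha> \<beta>.
     is_struct L B \<and> colourable l L B \<and> proper_substructure A B \<and>
     univ A = {1..\<alpha>} \<and> univ B = {1..\<beta>} \<and> \<phi> = ext_axiom l L S U c A B)"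

end

theory Submission
  imports Defs
begin

text \<open>The measure on coloured structures is the image of the uniform measure on independent choices of
  a colour for each vertex and a bit for each tuple, the bit of a non-monochromatic tuple deciding whether it is in
  the relation.  Fix a structure \<open>D\<close> with an \<open>l\<close>-colouring, a proper subset \<open>X\<close> of its universe and a
  colour-preserving embedding of \<open>X\<close>.  Linearly many disjoint blocks of new vertices each extend it to a
  colour-preserving embedding of \<open>D\<close>, independently and with probability bounded below, so all fail with
  exponentially small probability.  As there are polynomially many embeddings of \<open>X\<close>, with probability
  tending to 1 all of them extend.  With \<open>D = S\<close> and \<open>X\<close> the two last points of \<open>S\<close> this shows that \<open>xi\<close>
  defines the relation of having the same colour; then \<open>zeta\<close> makes the first \<open>l\<close> of the \<open>x\<^sub>i\<close>
  represent all colours, and the case \<open>D = B\<close>, \<open>X = A\<close> gives the extension axiom.\<close>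

section \<open>Counting\<close>

text \<open>Restriction to the last block and to the remaining coordinates is injective. On a block
  only one function agrees with \<open>g\<close> everywhere, so avoiding it leaves a fraction 1 -
  1/P of the P \<le> \<open>q\<close> functions on the block. Induction over the disjoint blocks
  multiplies these fractions.\<close>

lemma card_PiE_avoid:
  fixes S :: "'i \<Rightarrow> 'v set" and q :: real
  assumes "finite I" and S: "\<And>i. i \<in> I \<Longrightarrow> finite (S i)"
    and g: "\<And>i. i \<in> I \<Longrightarrow> g i \<in> S i"
    and J: "\<And>k. k < m \<Longrightarrow> J k \<subseteq> I"
    and disj: "\<And>k k'. k < m \<Longrightarrow> k' < m \<Longrightarrow> k \<noteq> k' \<Longrightarrow> J k \<inter> J k' = {}"
    and q: "\<And>k. k < m \<Longrightarrow> (\<Prod>i\<in>J k. real (card (S i))) \<le> q" and q1: "q \<ge> 1"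
  shows "real (card {f \<in> PiE I S. \<forall>k<m. \<exists>i\<in>J k. f i \<noteq> g i})
    \<le> (1 - 1 / q) ^ m * (\<Prod>i\<in>I. real (card (S i)))"
  using assms(1) S g J disj q
proof (induction m arbitrary: I)
  case 0
  then show ?case by (simp add: card_PiE)
next
  case (Suc m)
  define K where "K = J m"
  define I' where "I' = I - K"
  have K: "K \<subseteq> I" "finite K" and I': "finite I'"
    using Suc.prems(1,4) by (auto simp: K_def I'_def intro: finite_subset)
  define F where "F = {f \<in> PiE K S. \<exists>i\<in>K. f i \<noteq> g i}"
  define G where "G = {f \<in> PiE I' S. \<forall>k<m. \<exists>i\<in>J k. f i \<noteq> g i}"
  have JI': "J k \<subseteq> I'" if "k < m" for k
    using Suc.prems(4)[of k] Suc.prems(5)[of k m] that by (auto simp: K_def I'_def)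
  have "finite (PiE K S)" "finite (PiE I' S)"
    using K I' Suc.prems(2) by (auto intro!: finite_PiE simp: I'_def)
  then have fin: "finite F" "finite G"
    unfolding F_def G_def by auto
  let ?A = "{f \<in> PiE I S. \<forall>k<Suc m. \<exists>i\<in>J k. f i \<noteq> g i}"
  have "card ?A \<le> card (F \<times> G)"
  proof (rule card_inj_on_le)
    show "inj_on (\<lambda>f. (restrict f K, restrict f I')) ?A"
    proof (rule inj_onI)
      fix f f'
      assume *: "f \<in> ?A" "f' \<in> ?A" "(restrict f K, restrict f I') = (restrict f' K, restrict f' I')"
      then have "f i = f' i" if "i \<in> I" for i
        using that by (cases "i \<in> K") (auto simp: I'_def dest: fun_cong[of _ _ i])
      then show "f = f'" using * by (auto intro: PiE_ext)
    qed
    show "(\<lambda>f. (restrict f K, restrict f I')) ` ?A \<subseteq> F \<times> G"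
    proof (intro image_subsetI SigmaI)
      fix f assume f: "f \<in> ?A"
      then show "restrict f K \<in> F" using K by (auto simp: F_def K_def PiE_iff)
      have "\<exists>i\<in>J k. restrict f I' i \<noteq> g i" if "k < m" for k
      proof -
        have "k < Suc m" using that by simp
        moreover have "\<forall>k<Suc m. \<exists>i\<in>J k. f i \<noteq> g i" using f by simp
        ultimately obtain i where i: "i \<in> J k" "f i \<noteq> g i" by auto
        moreover have "i \<in> I'" using i(1) JI'[OF that] by (rule subsetD[rotated])
        ultimately show ?thesis by (metis restrict_apply')
      qed
      moreover have "restrict f I' \<in> PiE I' S" using f by (auto simp: I'_def)
      ultimately show "restrict f I' \<in> G" unfolding G_def by simp
    qed
    show "finite (F \<times> G)" using fin by simp
  qed
  then have cA: "real (card ?A) \<le> real (card F) * real (card G)"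
    by (simp add: card_cartesian_product flip: of_nat_mult)
  have gK: "restrict g K \<in> PiE K S" using K Suc.prems(3) by auto
  have "F = PiE K S - {restrict g K}"
  proof -
    have "(\<exists>i\<in>K. f i \<noteq> g i) \<longleftrightarrow> f \<noteq> restrict g K" if "f \<in> PiE K S" for f
    proof
      assume "f \<noteq> restrict g K"
      then show "\<exists>i\<in>K. f i \<noteq> g i" using PiE_ext[OF that gK] by auto
    qed auto
    then show ?thesis unfolding F_def by auto
  qed
  then have "card F = card (PiE K S) - 1" using gK by (simp add: card_Diff_singleton)
  moreover have "card (PiE K S) \<ge> 1"
  proof -
    have "finite (PiE K S)" using K Suc.prems(2) by (intro finite_PiE) auto
    then have "card (PiE K S) > 0" using gK by (metis card_gt_0_iff empty_iff)
    then show ?thesis by simp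
  qed
  ultimately have cF: "real (card F) = (\<Prod>i\<in>K. real (card (S i))) - 1"
    using K by (simp add: card_PiE of_nat_diff)
  define P where "P = (\<Prod>i\<in>K. real (card (S i)))"
  have P: "P \<le> q" "P \<ge> 1"
    using Suc.prems(6)[of m] cF \<open>card (PiE K S) \<ge> 1\<close> K by (auto simp: P_def K_def card_PiE simp flip: of_nat_prod)
  \<comment> \<open>After division by \<open>P\<close> this says
    \<open>P / q \<le> 1\<close>.\<close>
  have "P - 1 \<le> (1 - 1 / q) * P"
    using P q1 by (simp add: field_simps)
  then have cF': "real (card F) \<le> (1 - 1 / q) * P" by (simp add: cF P_def)
  have cG: "real (card G) \<le> (1 - 1 / q) ^ m * (\<Prod>i\<in>I'. real (card (S i)))"
    unfolding G_def by (rule Suc.IH) (use I' Suc.prems JI' in \<open>auto simp: I'_def\<close>)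
  have "real (card F) * real (card G)
      \<le> ((1 - 1 / q) * P) * ((1 - 1 / q) ^ m * (\<Prod>i\<in>I'. real (card (S i))))"
    using cF' cG P q1 by (intro mult_mono) auto
  also have "\<dots> = (1 - 1 / q) ^ Suc m * (P * (\<Prod>i\<in>I'. real (card (S i))))" by simp
  also have "P * (\<Prod>i\<in>I'. real (card (S i))) = (\<Prod>i\<in>I. real (card (S i)))"
    unfolding P_def I'_def using K Suc.prems(1) by (simp add: prod.subset_diff[of K I] mult.commute)
  finally show ?case using cA by linarith
qed

text \<open>For x > 0 write x = exp(-b d). The exponent m = (n - j) div d satisfies n \<le> m d + j
  + d, so the geometric factor is at most a constant times exp(-b n), which beats every power of
  n.\<close>

lemma poly_times_geometric_tendsto_0:
  fixes x :: real
  assumes "0 \<le> x" "x < 1" "d \<ge> 1"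
  shows "(\<lambda>n. real n ^ k * x ^ ((n - j) div d)) \<longlonglongrightarrow> 0"
proof (cases "x = 0")
  case True
  \<comment> \<open>From n = j + d on the exponent is positive; before that the power may be 0^0 =
    1.\<close>
  have "eventually (\<lambda>n. real n ^ k * x ^ ((n - j) div d) = 0) sequentially"
    using eventually_ge_at_top[of "j + d"]
  proof eventually_elim
    case (elim n)
    then have "(n - j) div d \<ge> 1" using assms(3) by (simp add: Suc_le_eq div_greater_zero_iff)
    then show ?case using True by simp
  qed
  then show ?thesis by (rule tendsto_eventually)
next
  case False
  define b where "b = - ln x / d"
  have b: "b > 0" using False assms by (auto simp: b_def divide_neg_pos)
  \<comment> \<open>The exponential pays for the shift by \<open>j\<close> and the rounding in
    \<open>div\<close>; dividing by \<open>b ^ k\<close> turns the power of n into a power of b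
    n.\<close>
  define C where "C = exp (b * real (j + d)) / b ^ k"
  have lim: "(\<lambda>n. C * ((b * real n) ^ k / exp (b * real n))) \<longlonglongrightarrow> 0"
  proof (rule tendsto_mult_right_zero, rule filterlim_compose[OF tendsto_power_div_exp_0])
    show "filterlim (\<lambda>n. b * real n) at_top sequentially"
      by (rule filterlim_tendsto_pos_mult_at_top[OF tendsto_const b filterlim_real_sequentially])
  qed
  show ?thesis
  proof (rule tendsto_sandwich[OF _ _ tendsto_const lim])
    show "eventually (\<lambda>n. 0 \<le> real n ^ k * x ^ ((n - j) div d)) sequentially"
      using assms by simp
    show "eventually (\<lambda>n. real n ^ k * x ^ ((n - j) div d)
        \<le> C * ((b * real n) ^ k / exp (b * real n))) sequentially"
    proof (rule always_eventually, rule allI)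
      fix n
      let ?m = "(n - j) div d"
      have "n - j = ?m * d + (n - j) mod d" by simp
      moreover have "(n - j) mod d < d" using assms(3) by simp
      ultimately have "n \<le> ?m * d + j + d" by linarith
      then have "real n \<le> real ?m * real d + real (j + d)"
        by (metis add.assoc of_nat_add of_nat_le_iff of_nat_mult)
      then have "b * real n \<le> b * (real ?m * real d + real (j + d))"
        using b by (intro mult_left_mono) auto
      then have *: "- (b * real d) * real ?m \<le> b * real (j + d) - b * real n" by (simp add: algebra_simps)
      have "x = exp (- (b * real d))" using False assms by (simp add: b_def)
      then have "x ^ ?m = exp (- (b * real d) * real ?m)"
        by (metis exp_of_nat_mult mult.commute)
      also have "\<dots> \<le> exp (b * real (j + d) - b * real n)" using * by simp
      also have "\<dots> = exp (b * real (j + d)) / exp (b * real n)" by (rule exp_diff)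
      finally have "real n ^ k * x ^ ?m \<le> real n ^ k * (exp (b * real (j + d)) / exp (b * real n))"
        by (intro mult_left_mono) auto
      also have "\<dots> = C * ((b * real n) ^ k / exp (b * real n))"
        using b by (simp add: C_def power_mult_distrib)
      finally show "real n ^ k * x ^ ?m \<le> C * ((b * real n) ^ k / exp (b * real n))" .
    qed
  qed
qed

section \<open>Coloured structures\<close>

definition tuples :: "'r lang \<Rightarrow> 'a set \<Rightarrow> ('r \<times> 'a list) set" where
  "tuples L V = (SIGMA R : syms L. {as. set as \<subseteq> V \<and> length as = arity L R})"

definition nonmono :: "('a \<Rightarrow> nat) \<Rightarrow> 'a list \<Rightarrow> bool" where
  "nonmono col as \<longleftrightarrow> (\<exists>a\<in>set as. \<exists>b\<in>set as. col a \<noteq> col b)"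

definition nonmono_tuples :: "'r lang \<Rightarrow> 'a set \<Rightarrow> ('a \<Rightarrow> nat) \<Rightarrow> ('r \<times> 'a list) set" where
  "nonmono_tuples L V col = {(R, as) \<in> tuples L V. nonmono col as}"

text \<open>All relations are packed into one set of symbol-tuple pairs, so that counting structures
  becomes counting pairs of a colouring and a set.\<close>

definition coloured_struct ::
  "nat \<Rightarrow> (nat \<Rightarrow> nat) \<Rightarrow> ('r \<times> nat list) set \<Rightarrow> ('r csym, nat) struct" where
  "coloured_struct n col T = \<lparr>univ = {1..n},
     intp = (\<lambda>R. case R of Rel R' \<Rightarrow> {as. (R', as) \<in> T} | Col i \<Rightarrow> {[a] | a. a \<in> {1..n} \<and> col a = i})\<rparr>"

lemma coloured_struct_sel [simp]:
  "univ (coloured_struct n col T) = {1..n}"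
  "intp (coloured_struct n col T) (Rel R) = {as. (R, as) \<in> T}"
  "intp (coloured_struct n col T) (Col i) = {[a] | a. a \<in> {1..n} \<and> col a = i}"
  by (simp_all add: coloured_struct_def)

lemma finite_tuples: "finite (syms L) \<Longrightarrow> finite V \<Longrightarrow> finite (tuples L V)"
  unfolding tuples_def by (intro finite_SigmaI finite_lists_length_eq)

lemma struct_eqI:
  fixes M N :: "('s, 'a) struct"
  shows "univ M = univ N \<Longrightarrow> (\<And>R. intp M R = intp N R) \<Longrightarrow> M = N"
  by (cases M; cases N) (auto simp: fun_eq_iff)

text \<open>The colour predicates return \<open>col\<close> on the universe, and extensionality
  fixes it elsewhere; the symbols \<open>Rel R\<close> return the slices of
  \<open>T\<close>.\<close>

lemma coloured_struct_eq_iff: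
  assumes "col \<in> {1..n} \<rightarrow>\<^sub>E {1..l}" "col' \<in> {1..n} \<rightarrow>\<^sub>E {1..l}"
  shows "coloured_struct n col T = coloured_struct n col' T' \<longleftrightarrow> col = col' \<and> T = T'"
proof
  assume *: "coloured_struct n col T = coloured_struct n col' T'"
  have "col a = col' a" if "a \<in> {1..n}" for a
  proof -
    have "[a] \<in> intp (coloured_struct n col T) (Col (col a))" using that by simp
    then show ?thesis unfolding * by simp
  qed
  then have "col = col'" using assms by (intro PiE_ext[OF assms]) blast
  moreover have "(R, as) \<in> T \<longleftrightarrow> as \<in> intp (coloured_struct n col T) (Rel R)" for R as by simp
  then have "(R, as) \<in> T \<longleftrightarrow> (R, as) \<in> T'" for R as unfolding * by simp
  ultimately show "col = col' \<and> T = T'" by auto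
qed auto

text \<open>Unique colours turn the colour predicates into a function, and the condition on the
  relations says that each related tuple meets two colours. There is no further constraint, so every
  set of non-monochromatic tuples occurs.\<close>

lemma KK_eq:
  "KK l L n = {coloured_struct n col T | col T.
     col \<in> {1..n} \<rightarrow>\<^sub>E {1..l} \<and> T \<subseteq> nonmono_tuples L {1..n} col}" (is "_ = ?K")
proof (intro subset_antisym subsetI)
  fix M assume M: "M \<in> KK l L n"
  then have uM: "univ M = {1..n}" and str: "is_struct (col_lang l L) M"
    and ex1: "\<And>a. a \<in> {1..n} \<Longrightarrow> \<exists>!i. i \<in> {1..l} \<and> [a] \<in> intp M (Col i)"
    and two: "\<And>R as. R \<in> syms L \<Longrightarrow> as \<in> intp M (Rel R) \<Longrightarrow>
      \<exists>a\<in>set as. \<exists>b\<in>set as. \<exists>i\<in>{1..l}. \<exists>j\<in>{1..l}.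
        i \<noteq> j \<and> [a] \<in> intp M (Col i) \<and> [b] \<in> intp M (Col j)"
    by (auto simp: KK_def)
  define col where "col = (\<lambda>a\<in>{1..n}. THE i. i \<in> {1..l} \<and> [a] \<in> intp M (Col i))"
  have col: "col a \<in> {1..l} \<and> [a] \<in> intp M (Col (col a))" if "a \<in> {1..n}" for a
    using theI'[OF ex1[OF that]] that by (simp add: col_def)
  have col_eq: "col a = i" if "a \<in> {1..n}" "i \<in> {1..l}" "[a] \<in> intp M (Col i)" for a i
    using ex1[OF that(1)] col[OF that(1)] that by auto
  define T where "T = {(R, as). as \<in> intp M (Rel R)}"
  have Rel: "R \<in> syms L \<and> length as = arity L R \<and> set as \<subseteq> {1..n}" if "as \<in> intp M (Rel R)" for R as
  proof -
    have "Rel R \<in> syms (col_lang l L)" using str that unfolding is_struct_def by auto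
    moreover from this have "R \<in> syms L" by (auto simp: col_lang_def)
    ultimately show ?thesis using str that uM by (fastforce simp: is_struct_def col_lang_def)
  qed
  have colD: "i \<in> {1..l} \<and> (\<exists>a\<in>{1..n}. as = [a])" if "as \<in> intp M (Col i)" for i as
  proof -
    have "Col i \<in> syms (col_lang l L)" using str that unfolding is_struct_def by auto
    moreover from this have "i \<in> {1..l}" by (auto simp: col_lang_def)
    ultimately have "length as = 1" "set as \<subseteq> {1..n}"
      using str that uM by (fastforce simp: is_struct_def col_lang_def)+
    then show ?thesis using \<open>i \<in> {1..l}\<close> by (auto simp: length_Suc_conv)
  qed
  have "T \<subseteq> nonmono_tuples L {1..n} col"
  proof (rule subrelI, unfold T_def mem_Collect_eq prod.case)
    fix R as assume as: "as \<in> intp M (Rel R)"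
    from two[of R, OF _ as] Rel[OF as] obtain a b i j where "a \<in> set as" "b \<in> set as"
      "i \<in> {1..l}" "j \<in> {1..l}" "i \<noteq> j" "[a] \<in> intp M (Col i)" "[b] \<in> intp M (Col j)" by blast
    then have "nonmono col as"
      using col_eq Rel[OF as] unfolding nonmono_def by (metis subsetD)
    then show "(R, as) \<in> nonmono_tuples L {1..n} col"
      using Rel[OF as] by (simp add: nonmono_tuples_def tuples_def)
  qed
  moreover have "M = coloured_struct n col T"
  proof (rule struct_eqI)
    fix R show "intp M R = intp (coloured_struct n col T) R"
    proof (cases R)
      case (Col i)
      have "as \<in> intp M (Col i) \<longleftrightarrow> (\<exists>a. as = [a] \<and> a \<in> {1..n} \<and> col a = i)" for as
        using colD[of as i] col_eq[of _ i] col by blast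
      then have "intp M (Col i) = {[a] | a. a \<in> {1..n} \<and> col a = i}" by blast
      then show ?thesis using Col by simp
    qed (simp add: T_def)
  qed (simp add: uM)
  moreover have "col \<in> {1..n} \<rightarrow>\<^sub>E {1..l}"
    using col by (auto simp: col_def)
  ultimately show "M \<in> ?K" by blast
next
  fix M assume "M \<in> ?K"
  then obtain col T where M: "M = coloured_struct n col T" and col: "col \<in> {1..n} \<rightarrow>\<^sub>E {1..l}"
    and T: "T \<subseteq> nonmono_tuples L {1..n} col" by blast
  have "is_struct (col_lang l L) M"
    using T col unfolding is_struct_def M
  proof (intro conjI ballI allI impI)
    fix R as assume R: "R \<in> syms (col_lang l L)" and as: "as \<in> intp (coloured_struct n col T) R"
    show "length as = arity (col_lang l L) R"
      using R as T by (cases R) (auto simp: col_lang_def nonmono_tuples_def tuples_def)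
    show "set as \<subseteq> univ (coloured_struct n col T)"
      using R as T by (cases R) (auto simp: nonmono_tuples_def tuples_def)
  next
    fix R assume R: "R \<notin> syms (col_lang l L)"
    show "intp (coloured_struct n col T) R = {}"
    proof (cases R)
      case (Col i)
      \<comment> \<open>The range of \<open>col\<close> keeps the predicates of colours outside 1..l
        empty.\<close>
      then have "i \<notin> {1..l}" using R by (auto simp: col_lang_def)
      then show ?thesis using Col col by (auto simp: PiE_iff)
    qed (use R T in \<open>auto simp: col_lang_def nonmono_tuples_def tuples_def\<close>)
  qed
  moreover have "\<exists>a\<in>set as. \<exists>b\<in>set as. \<exists>i\<in>{1..l}. \<exists>j\<in>{1..l}.
        i \<noteq> j \<and> [a] \<in> intp M (Col i) \<and> [b] \<in> intp M (Col j)" if "as \<in> intp M (Rel R)" for R as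
  proof -
    have "nonmono col as" "set as \<subseteq> {1..n}"
      using that T by (auto simp: M nonmono_tuples_def tuples_def)
    then obtain a b where "a \<in> set as" "b \<in> set as" "col a \<noteq> col b" "a \<in> {1..n}" "b \<in> {1..n}"
      unfolding nonmono_def by (meson subsetD)
    then show ?thesis using col unfolding M
      by (intro bexI[of _ a] bexI[of _ b] bexI[of _ "col a"] bexI[of _ "col b"]) auto
  qed
  moreover have "\<exists>!i. i \<in> {1..l} \<and> [a] \<in> intp M (Col i)" if "a \<in> univ M" for a
    using that col by (intro ex1I[of _ "col a"]) (auto simp: M)
  ultimately show "M \<in> KK l L n"
    unfolding KK_def by (simp add: M)
qed

section \<open>Truncations and their point masses\<close>

definition nonmono_upto ::
  "'r lang \<Rightarrow> 'a set \<Rightarrow> ('a \<Rightarrow> nat) \<Rightarrow> nat \<Rightarrow> ('r \<times> 'a list) set" where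
  "nonmono_upto L V col r = {(R, as) \<in> nonmono_tuples L V col. card (set as) \<le> r}"

lemma finite_nonmono_upto:
  "finite (syms L) \<Longrightarrow> finite V \<Longrightarrow> finite (nonmono_upto L V col r)"
  by (rule finite_subset[OF _ finite_tuples[of L V]])
    (auto simp: nonmono_upto_def nonmono_tuples_def)

text \<open>A colour fact has exactly one distinct entry, so the colouring survives truncation at
  every level from 1 on and only the relations are cut down.\<close>

lemma trunc_coloured_struct:
  assumes "r \<ge> 1"
  shows "trunc r (coloured_struct n col T) = coloured_struct n col {(R, as) \<in> T. card (set as) \<le> r}"
proof (rule struct_eqI)
  fix R
  show "intp (trunc r (coloured_struct n col T)) R
      = intp (coloured_struct n col {(R, as) \<in> T. card (set as) \<le> r}) R"
    using assms by (cases R) (auto simp: trunc_def)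
qed (simp add: trunc_def)

text \<open>Level 0 keeps only empty tuples; colour facts have one entry and non-monochromatic
  tuples at least two distinct ones.\<close>

lemma trunc_0_coloured_struct:
  assumes "T \<subseteq> nonmono_tuples L {1..n} col"
  shows "trunc 0 (coloured_struct n col T) = \<lparr>univ = {1..n}, intp = (\<lambda>_. {})\<rparr>"
proof (rule struct_eqI)
  fix R
  show "intp (trunc 0 (coloured_struct n col T)) R = intp \<lparr>univ = {1..n}, intp = (\<lambda>_. {})\<rparr> R"
    using assms by (cases R) (auto simp: trunc_def nonmono_tuples_def nonmono_def)
qed (simp add: trunc_def)

text \<open>A set of tuples within level \<open>r\<close> is unchanged by the truncation, so each
  structure on the right lies in \<open>KK\<close> and is its own truncation.\<close>

lemma Ktrunc_eq:
  assumes "r \<ge> 1"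
  shows "Ktrunc l L n r = {coloured_struct n col T | col T.
     col \<in> {1..n} \<rightarrow>\<^sub>E {1..l} \<and> T \<subseteq> nonmono_upto L {1..n} col r}" (is "_ = ?K")
proof (intro subset_antisym subsetI)
  fix M assume "M \<in> Ktrunc l L n r"
  then obtain col T where *: "M = trunc r (coloured_struct n col T)"
    "col \<in> {1..n} \<rightarrow>\<^sub>E {1..l}" "T \<subseteq> nonmono_tuples L {1..n} col"
    unfolding Ktrunc_def KK_eq by auto
  then have "M = coloured_struct n col {(R, as) \<in> T. card (set as) \<le> r}"
    using trunc_coloured_struct[OF assms] by simp
  moreover have "{(R, as) \<in> T. card (set as) \<le> r} \<subseteq> nonmono_upto L {1..n} col r"
    using *(3) by (auto simp: nonmono_upto_def)
  ultimately show "M \<in> ?K" using *(2) by blast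
next
  fix M assume "M \<in> ?K"
  then obtain col T where *: "M = coloured_struct n col T"
    "col \<in> {1..n} \<rightarrow>\<^sub>E {1..l}" "T \<subseteq> nonmono_upto L {1..n} col r" by blast
  then have "{(R, as) \<in> T. card (set as) \<le> r} = T" "T \<subseteq> nonmono_tuples L {1..n} col"
    by (auto simp: nonmono_upto_def)
  then have "M = trunc r M" "M \<in> KK l L n"
    using *(1,2) by (auto simp: trunc_coloured_struct[OF assms] KK_eq)
  then show "M \<in> Ktrunc l L n r" unfolding Ktrunc_def by blast
qed

text \<open>Level 0 has a single structure, level 1 adds exactly the choice of a colouring, and each
  later level adds a free choice among the allowed tuples with one more distinct entry. The divisors
  in \<open>mass\<close> count these choices.\<close>

lemma mass_coloured_struct:
  fixes L :: "'r lang"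
  assumes fin: "finite (syms L)" and r: "r \<ge> 1"
    and col: "col \<in> {1..n} \<rightarrow>\<^sub>E {1..l}" and T: "T \<subseteq> nonmono_upto L {1..n} col r"
  shows "mass l L n r (coloured_struct n col T)
    = 1 / (real l ^ n * 2 ^ card (nonmono_upto L {1..n} col r))"
  using r T
proof (induction r arbitrary: T rule: nat_induct_at_least)
  case base
  let ?E = "\<lparr>univ = {1..n}, intp = (\<lambda>_. {})\<rparr> :: ('r csym, nat) struct"
  \<comment> \<open>A non-monochromatic tuple has two distinct entries, so at level 1 the relations
    are still empty.\<close>
  have one: "nonmono_upto L {1..n} col' 1 = {}" for col'
  proof -
    have "\<not> card (set as) \<le> 1" if "nonmono col' as" for as
      using that card_le_Suc0_iff_eq[of "set as"] by (auto simp: nonmono_def)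
    then show ?thesis by (auto simp: nonmono_upto_def nonmono_tuples_def)
  qed
  have tr0: "trunc 0 (coloured_struct n col' {}) = ?E" for col'
    by (rule trunc_0_coloured_struct[where L = L]) simp
  have "Ktrunc l L n 0 = {?E}"
  proof (intro subset_antisym subsetI)
    fix M assume "M \<in> Ktrunc l L n 0"
    then obtain col' T' where "M = trunc 0 (coloured_struct n col' T')"
      "T' \<subseteq> nonmono_tuples L {1..n} col'"
      unfolding Ktrunc_def KK_eq by blast
    then show "M \<in> {?E}" by (simp add: trunc_0_coloured_struct)
  next
    have "coloured_struct n col {} \<in> KK l L n" using col unfolding KK_eq by blast
    then have "trunc 0 (coloured_struct n col {}) \<in> Ktrunc l L n 0"
      unfolding Ktrunc_def by (rule imageI)
    then show "M \<in> Ktrunc l L n 0" if "M \<in> {?E}" for M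
      using that unfolding tr0 by simp
  qed
  \<comment> \<open>All members of level 1 have the same truncation at level 0, so the first divisor
    is the number of colourings.\<close>
  moreover have "{B' \<in> Ktrunc l L n 1. trunc 0 B' = trunc 0 (coloured_struct n col T)}
      = (\<lambda>col'. coloured_struct n col' {}) ` ({1..n} \<rightarrow>\<^sub>E {1..l})"
  proof -
    have "T = {}" using base unfolding one by blast
    then show ?thesis unfolding Ktrunc_eq[OF order.refl] one by (auto simp only: tr0 subset_empty)
  qed
  moreover have "card ((\<lambda>col'. coloured_struct n col' {} :: ('r csym, nat) struct) ` ({1..n} \<rightarrow>\<^sub>E {1..l})) = l ^ n"
    by (subst card_image) (auto intro!: inj_onI simp: coloured_struct_eq_iff card_PiE)
  ultimately show ?case using one by simp
next
  case (Suc r)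
  let ?N = "nonmono_upto L {1..n} col"
  have NN: "?N r \<subseteq> ?N (Suc r)" by (auto simp: nonmono_upto_def)
  have finN: "finite (?N k)" for k using fin by (simp add: finite_nonmono_upto)
  have cut: "{(R, as) \<in> T'. card (set as) \<le> r} = T' \<inter> ?N r"
    if "T' \<subseteq> nonmono_upto L {1..n} col' (Suc r)" "col' = col" for T' col'
    using that by (auto simp: nonmono_upto_def)
  have tr: "trunc r (coloured_struct n col T') = coloured_struct n col (T' \<inter> ?N r)"
    if "T' \<subseteq> ?N (Suc r)" for T'
    using trunc_coloured_struct[OF Suc.hyps, of n col T'] cut[OF that refl] by simp
  \<comment> \<open>As \<open>r \<ge> 1\<close>, the truncation determines the colouring; what stays
    free is a set \<open>Z\<close> of allowed tuples with exactly \<open>Suc r\<close> distinct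
    entries.\<close>
  have "{B' \<in> Ktrunc l L n (Suc r). trunc r B' = trunc r (coloured_struct n col T)}
      = (\<lambda>Z. coloured_struct n col ((T \<inter> ?N r) \<union> Z)) ` Pow (?N (Suc r) - ?N r)" (is "?L = ?R")
  proof (intro subset_antisym subsetI)
    fix M assume "M \<in> ?L"
    then obtain col' T' where *: "M = coloured_struct n col' T'"
      "col' \<in> {1..n} \<rightarrow>\<^sub>E {1..l}" "T' \<subseteq> nonmono_upto L {1..n} col' (Suc r)"
      "trunc r (coloured_struct n col' T') = trunc r (coloured_struct n col T)"
      by (auto simp: Ktrunc_eq)
    from *(4) have "col' = col"
      using *(2) col by (simp add: trunc_coloured_struct[OF Suc.hyps] coloured_struct_eq_iff)
    with * have T': "T' \<subseteq> ?N (Suc r)" by simp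
    have "T' \<inter> ?N r = T \<inter> ?N r"
      using *(4) col unfolding \<open>col' = col\<close> tr[OF T'] tr[OF Suc.prems]
      by (simp add: coloured_struct_eq_iff)
    then have "T' = (T \<inter> ?N r) \<union> (T' - ?N r)" by blast
    then have "M = coloured_struct n col ((T \<inter> ?N r) \<union> (T' - ?N r))"
      using *(1) \<open>col' = col\<close> by simp
    then show "M \<in> ?R" using T' by blast
  next
    fix M assume "M \<in> ?R"
    then obtain Z where Z: "M = coloured_struct n col ((T \<inter> ?N r) \<union> Z)" "Z \<subseteq> ?N (Suc r) - ?N r"
      by blast
    then have sub: "(T \<inter> ?N r) \<union> Z \<subseteq> ?N (Suc r)" using NN by blast
    have "((T \<inter> ?N r) \<union> Z) \<inter> ?N r = T \<inter> ?N r" using Z by blast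
    then have "trunc r M = trunc r (coloured_struct n col T)"
      using tr[OF sub] tr[OF Suc.prems] by (simp add: Z(1))
    moreover have "M \<in> Ktrunc l L n (Suc r)"
    proof -
      have "1 \<le> Suc r" by simp
      from Ktrunc_eq[OF this] show ?thesis using sub col Z(1) by blast
    qed
    ultimately show "M \<in> ?L" by simp
  qed
  moreover have "card ?R = 2 ^ (card (?N (Suc r)) - card (?N r))"
  proof (subst card_image)
    show "inj_on (\<lambda>Z. coloured_struct n col ((T \<inter> ?N r) \<union> Z)) (Pow (?N (Suc r) - ?N r))"
    proof (rule inj_onI)
      fix Y Z
      assume *: "Y \<in> Pow (?N (Suc r) - ?N r)" "Z \<in> Pow (?N (Suc r) - ?N r)"
        "coloured_struct n col ((T \<inter> ?N r) \<union> Y) = coloured_struct n col ((T \<inter> ?N r) \<union> Z)"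
      from *(3) have "(T \<inter> ?N r) \<union> Y = (T \<inter> ?N r) \<union> Z"
        unfolding coloured_struct_eq_iff[OF col col] by (rule conjunct2)
      then show "Y = Z" using *(1,2) by blast
    qed
    show "card (Pow (?N (Suc r) - ?N r)) = 2 ^ (card (?N (Suc r)) - card (?N r))"
      using finN NN by (simp add: card_Pow card_Diff_subset)
  qed
  moreover have "card (?N r) \<le> card (?N (Suc r))" using NN finN by (rule card_mono[rotated])
  then have "(2::real) ^ card (?N (Suc r)) = 2 ^ card (?N r) * 2 ^ (card (?N (Suc r)) - card (?N r))"
    by (simp flip: power_add)
  ultimately show ?case unfolding mass.simps tr[OF Suc.prems] using Suc.IH[of "T \<inter> ?N r"] by simp
qed

section \<open>Independent configurations and the measure they induce\<close>

text \<open>A configuration assigns a colour to each vertex and a bit to each tuple.  The bits of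
  monochromatic tuples are ignored; keeping them makes all coordinates independent, while every structure
  over a given colouring still has the same number of configurations.\<close>

definition index :: "'r lang \<Rightarrow> nat \<Rightarrow> (nat + 'r \<times> nat list) set" where
  "index L n = Inl ` {1..n} \<union> Inr ` tuples L {1..n}"

text \<open>Bits are natural numbers so that colours and bits fit into one dependent
  product.\<close>

definition vals :: "nat \<Rightarrow> nat + 'r \<times> nat list \<Rightarrow> nat set" where
  "vals l x = (case x of Inl _ \<Rightarrow> {1..l} | Inr _ \<Rightarrow> {0, 1})"

definition configs :: "nat \<Rightarrow> 'r lang \<Rightarrow> nat \<Rightarrow> (nat + 'r \<times> nat list \<Rightarrow> nat) set" where
  "configs l L n = PiE (index L n) (vals l)"

definition conf_col :: "nat \<Rightarrow> (nat + 'r \<times> nat list \<Rightarrow> nat) \<Rightarrow> nat \<Rightarrow> nat" where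
  "conf_col n f = (\<lambda>v\<in>{1..n}. f (Inl v))"

definition conf_rel :: "'r lang \<Rightarrow> nat \<Rightarrow> (nat + 'r \<times> nat list \<Rightarrow> nat) \<Rightarrow> ('r \<times> nat list) set" where
  "conf_rel L n f = {x \<in> nonmono_tuples L {1..n} (conf_col n f). f (Inr x) = 1}"

definition conf_struct ::
  "'r lang \<Rightarrow> nat \<Rightarrow> (nat + 'r \<times> nat list \<Rightarrow> nat) \<Rightarrow> ('r csym, nat) struct" where
  "conf_struct L n f = coloured_struct n (conf_col n f) (conf_rel L n f)"

lemma finite_index: "finite (syms L) \<Longrightarrow> finite (index L n)"
  by (simp add: index_def finite_tuples)

lemma finite_vals: "finite (vals l x)"
  by (cases x) (auto simp: vals_def)

lemma finite_configs: "finite (syms L) \<Longrightarrow> finite (configs l L n)"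
  by (simp add: configs_def finite_PiE finite_index finite_vals)

lemma conf_col_in: "f \<in> configs l L n \<Longrightarrow> conf_col n f \<in> {1..n} \<rightarrow>\<^sub>E {1..l}"
  by (force simp: configs_def conf_col_def index_def vals_def PiE_iff)

lemma conf_struct_in_KK: "f \<in> configs l L n \<Longrightarrow> conf_struct L n f \<in> KK l L n"
  unfolding KK_eq conf_struct_def using conf_col_in[of f l L n] by (auto simp: conf_rel_def)

lemma prod_index:
  assumes "finite (syms L)"
  shows "(\<Prod>x\<in>index L n. g x) = (\<Prod>v\<in>{1..n}. g (Inl v)) * (\<Prod>x\<in>tuples L {1..n}. g (Inr x))"
  unfolding index_def using assms
  by (subst prod.union_disjoint) (auto simp: finite_tuples prod.reindex)

lemma card_configs:
  fixes L :: "'r lang"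
  assumes "finite (syms L)"
  shows "card (configs l L n) = l ^ n * 2 ^ card (tuples L {1..n})"
proof -
  have "card (vals l (Inl v :: nat + 'r \<times> nat list)) = l" "card (vals l (Inr x :: nat + 'r \<times> nat list)) = 2" for v x
    by (simp_all add: vals_def)
  then show ?thesis
    unfolding configs_def card_PiE[OF finite_index[OF assms]] prod_index[OF assms] by simp
qed

text \<open>The structure forces the vertex coordinates and the bits of non-monochromatic tuples and
  leaves the other bits free, so the fibre is the product of the value sets \<open>S\<close>
  below.\<close>

lemma card_fibre:
  fixes L :: "'r lang"
  assumes fin: "finite (syms L)" and col: "col \<in> {1..n} \<rightarrow>\<^sub>E {1..l}"
    and T: "T \<subseteq> nonmono_tuples L {1..n} col"
  shows "card {f \<in> configs l L n. conf_struct L n f = coloured_struct n col T}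
    = 2 ^ card (tuples L {1..n} - nonmono_tuples L {1..n} col)"
proof -
  let ?N = "nonmono_tuples L {1..n} col"
  have N: "?N \<subseteq> tuples L {1..n}" by (auto simp: nonmono_tuples_def)
  define S where "S x = (case x of Inl v \<Rightarrow> {col v}
    | Inr t \<Rightarrow> if t \<in> ?N then {if t \<in> T then 1 else 0} else {0, 1::nat})" for x
  have S: "S (Inl v) = {col v}"
    "S (Inr t) = (if t \<in> ?N then {if t \<in> T then 1 else 0} else {0, 1})" for v t
    by (simp_all add: S_def)
  have "conf_struct L n f = coloured_struct n col T \<longleftrightarrow> f \<in> PiE (index L n) S"
    if f: "f \<in> configs l L n" for f
  proof -
    have f2: "f (Inr t) \<in> {0, 1}" if "t \<in> tuples L {1..n}" for t
      using f that by (force simp: configs_def index_def vals_def PiE_iff)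
    have ext: "f \<in> extensional (index L n)" using f by (auto simp: configs_def PiE_iff)
    have "conf_struct L n f = coloured_struct n col T
        \<longleftrightarrow> conf_col n f = col \<and> conf_rel L n f = T"
      unfolding conf_struct_def using conf_col_in[OF f] col by (rule coloured_struct_eq_iff)
    also have "\<dots> \<longleftrightarrow> conf_col n f = col \<and> {t \<in> ?N. f (Inr t) = 1} = T"
      unfolding conf_rel_def by (intro conj_cong refl) simp
    also have "conf_col n f = col \<longleftrightarrow> (\<forall>v\<in>{1..n}. f (Inl v) = col v)"
      using col by (auto simp: conf_col_def fun_eq_iff PiE_iff extensional_def)
    also have "{t \<in> ?N. f (Inr t) = 1} = T \<longleftrightarrow> (\<forall>t\<in>tuples L {1..n}. f (Inr t) \<in> S (Inr t))"
    proof
      assume eq: "{t \<in> ?N. f (Inr t) = 1} = T"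
      show "\<forall>t\<in>tuples L {1..n}. f (Inr t) \<in> S (Inr t)"
      proof
        fix t assume "t \<in> tuples L {1..n}"
        then have "f (Inr t) \<in> {0, 1}" by (rule f2)
        moreover have "f (Inr t) = 1 \<longleftrightarrow> t \<in> T" if "t \<in> ?N"
          using that unfolding eq[symmetric] by simp
        ultimately show "f (Inr t) \<in> S (Inr t)" unfolding S by auto
      qed
    next
      assume all: "\<forall>t\<in>tuples L {1..n}. f (Inr t) \<in> S (Inr t)"
      have "f (Inr t) = (if t \<in> T then 1 else 0)" if "t \<in> ?N" for t
        using bspec[OF all subsetD[OF N that]] that unfolding S by simp
      then have "f (Inr t) = 1 \<longleftrightarrow> t \<in> T" if "t \<in> ?N" for t using that by simp
      then show "{t \<in> ?N. f (Inr t) = 1} = T" using T by blast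
    qed
    finally show ?thesis using ext by (simp add: PiE_iff index_def ball_Un S(1))
  qed
  moreover have "PiE (index L n) S \<subseteq> configs l L n"
    unfolding configs_def using col by (intro PiE_mono) (auto simp: index_def vals_def S split: if_splits)
  ultimately have "{f \<in> configs l L n. conf_struct L n f = coloured_struct n col T} = PiE (index L n) S"
    by blast
  \<comment> \<open>Forced bits contribute a factor 1, so a factor 2 remains for each monochromatic
    tuple.\<close>
  moreover have "(\<Prod>x\<in>tuples L {1..n}. card (S (Inr x))) = (\<Prod>x\<in>tuples L {1..n} - ?N. 2)"
    using fin by (intro prod.mono_neutral_cong_right) (auto simp: S finite_tuples)
  ultimately show ?thesis
    using fin by (simp add: card_PiE finite_index prod_index S(1))
qed

text \<open>A structure whose colouring allows N of the t tuples has 2^(t - N) of the l^n 2^t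
  configurations, and this share is its point mass 1 / (l^n 2^N).\<close>

lemma \<delta>K_eq_card:
  fixes L :: "'r lang"
  assumes fin: "finite (syms L)" and ne: "syms L \<noteq> {}" and ar: "\<forall>R\<in>syms L. arity L R \<ge> 2"
    and Y: "Y \<subseteq> KK l L n"
  shows "\<delta>K l L n Y = real (card {f \<in> configs l L n. conf_struct L n f \<in> Y}) / real (card (configs l L n))"
proof -
  define r where "r = max_arity (col_lang l L)"
  have ge: "arity L R \<le> r" if "R \<in> syms L" for R
  proof -
    have "arity (col_lang l L) (Rel R) \<le> r"
      unfolding r_def max_arity_def
    proof (intro Max_ge imageI)
      show "finite (arity (col_lang l L) ` syms (col_lang l L))" using fin by (simp add: col_lang_def)
      show "Rel R \<in> syms (col_lang l L)" using that by (simp add: col_lang_def)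
    qed
    then show ?thesis by (simp add: col_lang_def)
  qed
  have r1: "r \<ge> 1" using ne ar ge by fastforce
  \<comment> \<open>A tuple has at most as many distinct entries as its arity, so level
    \<open>r\<close> already contains all tuples.\<close>
  have upto: "nonmono_upto L {1..n} col r = nonmono_tuples L {1..n} col" for col
  proof -
    have "card (set as) \<le> r" if "(R, as) \<in> tuples L {1..n}" for R as
      using that ge[of R] card_length[of as] by (auto simp: tuples_def)
    then show ?thesis by (auto simp: nonmono_upto_def nonmono_tuples_def)
  qed
  let ?fib = "\<lambda>M. {f \<in> configs l L n. conf_struct L n f = M}"
  have mass: "mass l L n r M = real (card (?fib M)) / real (card (configs l L n))" if "M \<in> KK l L n" for M
  proof -
    from that obtain col T where M: "M = coloured_struct n col T" and col: "col \<in> {1..n} \<rightarrow>\<^sub>E {1..l}"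
      and T: "T \<subseteq> nonmono_tuples L {1..n} col" by (auto simp: KK_eq)
    let ?N = "nonmono_tuples L {1..n} col"
    have sub: "?N \<subseteq> tuples L {1..n}" and fT: "finite (tuples L {1..n})"
      using fin by (auto simp: nonmono_tuples_def finite_tuples)
    have "card (tuples L {1..n}) = card ?N + card (tuples L {1..n} - ?N)"
      using sub fT by (metis card_Diff_subset card_mono finite_subset le_add_diff_inverse)
    then show ?thesis
      using mass_coloured_struct[OF fin r1 col, of T, unfolded upto, OF T] card_fibre[OF fin col T]
      by (simp add: M card_configs[OF fin] power_add)
  qed
  \<comment> \<open>Adding up the disjoint fibres requires a finite index set.\<close>
  have finY: "finite Y"
  proof (rule finite_subset[OF Y])
    have "KK l L n \<subseteq> (\<lambda>(col, T). coloured_struct n col T) ` (({1..n} \<rightarrow>\<^sub>E {1..l}) \<times> Pow (tuples L {1..n}))"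
    proof
      fix M assume "M \<in> KK l L n"
      then obtain col T where "M = coloured_struct n col T" "col \<in> {1..n} \<rightarrow>\<^sub>E {1..l}"
        "T \<subseteq> nonmono_tuples L {1..n} col" unfolding KK_eq by blast
      moreover have "nonmono_tuples L {1..n} col \<subseteq> tuples L {1..n}" by (auto simp: nonmono_tuples_def)
      ultimately show "M \<in> (\<lambda>(col, T). coloured_struct n col T) ` (({1..n} \<rightarrow>\<^sub>E {1..l}) \<times> Pow (tuples L {1..n}))"
        by (intro image_eqI[of _ _ "(col, T)"]) auto
    qed
    then show "finite (KK l L n)"
      by (rule finite_subset) (use fin in \<open>intro finite_imageI finite_cartesian_product finite_PiE; simp add: finite_tuples\<close>)
  qed
  have "{f \<in> configs l L n. conf_struct L n f \<in> Y} = (\<Union>M\<in>Y. ?fib M)" by auto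
  also have "card \<dots> = (\<Sum>M\<in>Y. card (?fib M))"
    by (rule card_UN_disjoint) (use finY finite_configs[OF fin] in auto)
  finally have card: "real (card {f \<in> configs l L n. conf_struct L n f \<in> Y}) = (\<Sum>M\<in>Y. real (card (?fib M)))"
    by simp
  have "\<delta>K l L n Y = (\<Sum>M\<in>Y. real (card (?fib M)) / real (card (configs l L n)))"
    unfolding \<delta>K_def r_def[symmetric] using Y mass by (intro sum.cong) auto
  then show ?thesis unfolding card sum_divide_distrib .
qed

section \<open>Extending coloured embeddings\<close>

text \<open>Colours are preserved exactly, not just up to a permutation. The domain \<open>X\<close>
  is separate from \<open>D\<close> because partial embeddings are to be extended.\<close>

definition coloured_emb ::
  "'r lang \<Rightarrow> ('r, nat) struct \<Rightarrow> (nat \<Rightarrow> nat) \<Rightarrow> nat \<Rightarrow> (nat + 'r \<times> nat list \<Rightarrow> nat) \<Rightarrow>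
   nat set \<Rightarrow> (nat \<Rightarrow> nat) \<Rightarrow> bool" where
  "coloured_emb L D \<gamma> n f X h \<longleftrightarrow> inj_on h X \<and> h ` X \<subseteq> {1..n} \<and> (\<forall>i\<in>X. f (Inl (h i)) = \<gamma> i) \<and>
     (\<forall>(R, is)\<in>tuples L X. (R, map h is) \<in> conf_rel L n f \<longleftrightarrow> is \<in> intp D R)"

definition all_extend ::
  "'r lang \<Rightarrow> ('r, nat) struct \<Rightarrow> (nat \<Rightarrow> nat) \<Rightarrow> nat set \<Rightarrow> nat \<Rightarrow> (nat + 'r \<times> nat list \<Rightarrow> nat) \<Rightarrow> bool"
  where
  "all_extend L D \<gamma> X n f \<longleftrightarrow> (\<forall>h. coloured_emb L D \<gamma> n f X h \<longrightarrow>
     (\<exists>h'. (\<forall>i\<in>X. h' i = h i) \<and> coloured_emb L D \<gamma> n f (univ D) h'))"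

lemma coloured_emb_cong:
  assumes h: "coloured_emb L D \<gamma> n f X h" and eq: "\<And>i. i \<in> X \<Longrightarrow> h i = h' i"
  shows "coloured_emb L D \<gamma> n f X h'"
proof -
  have "(R, map h' is) \<in> conf_rel L n f \<longleftrightarrow> is \<in> intp D R" if t: "(R, is) \<in> tuples L X" for R "is"
  proof -
    have m: "map h' is = map h is" using t eq by (auto simp: tuples_def)
    show ?thesis unfolding m using h t by (auto simp: coloured_emb_def)
  qed
  moreover have "h' ` X = h ` X" using eq by (intro image_cong) auto
  moreover have "inj_on h' X" using h inj_on_cong[of X h h'] eq by (auto simp: coloured_emb_def)
  ultimately show ?thesis using h eq by (auto simp: coloured_emb_def)
qed

text \<open>An empty tuple would be monochromatic in every colour at once, so the tuple has an
  entry, and some other entry differs from it in colour.\<close>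

lemma nonmono_if_colouring:
  assumes "\<gamma> \<in> colourings l L D" "R \<in> syms L" "is \<in> intp D R"
  shows "nonmono \<gamma> is"
proof -
  have no: "\<not> (\<exists>c. \<forall>a\<in>set is. \<gamma> a = c)"
    using assms by (auto simp: colourings_def)
  then obtain a where "a \<in> set is" by blast
  with no show ?thesis unfolding nonmono_def by metis
qed

lemma colouringI:
  assumes "\<gamma> \<in> univ D \<rightarrow>\<^sub>E {1..l}" "\<And>R is. R \<in> syms L \<Longrightarrow> is \<in> intp D R \<Longrightarrow> nonmono \<gamma> is"
  shows "\<gamma> \<in> colourings l L D"
  unfolding colourings_def
proof (intro CollectI conjI ballI)
  fix R "is" assume "R \<in> syms L" "is \<in> intp D R"
  from assms(2)[OF this] show "\<not> (\<exists>c. \<forall>a\<in>set is. \<gamma> a = c)" unfolding nonmono_def by metis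
qed (rule assms(1))

text \<open>Tuples inside \<open>X\<close> are settled by \<open>h\<close>, all others by their
  prescribed bits. A bit 1 does count: the tuple is related in \<open>D\<close>, hence
  non-monochromatic under \<open>\<gamma>\<close>, and its image has the same colours.\<close>

lemma coloured_emb_extend:
  assumes \<gamma>: "\<gamma> \<in> colourings l L D" and X: "X \<subseteq> univ D"
    and h: "coloured_emb L D \<gamma> n f X h" and agree: "\<And>i. i \<in> X \<Longrightarrow> h' i = h i"
    and inj: "inj_on h' (univ D)" and ran: "h' ` univ D \<subseteq> {1..n}"
    and col: "\<And>i. i \<in> univ D - X \<Longrightarrow> f (Inl (h' i)) = \<gamma> i"
    and rel: "\<And>R is. (R, is) \<in> tuples L (univ D) - tuples L X \<Longrightarrow>
      f (Inr (R, map h' is)) = (if is \<in> intp D R then 1 else 0)"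
  shows "coloured_emb L D \<gamma> n f (univ D) h'"
proof -
  have h': "coloured_emb L D \<gamma> n f X h'"
    using h by (rule coloured_emb_cong) (simp add: agree)
  have col': "f (Inl (h' i)) = \<gamma> i" if "i \<in> univ D" for i
    using h' col that by (cases "i \<in> X") (auto simp: coloured_emb_def)
  have cc: "conf_col n f (h' i) = \<gamma> i" if "i \<in> univ D" for i
    using col'[OF that] ran that by (auto simp: conf_col_def)
  have "(R, map h' is) \<in> conf_rel L n f \<longleftrightarrow> is \<in> intp D R" if t: "(R, is) \<in> tuples L (univ D)" for R "is"
  proof (cases "(R, is) \<in> tuples L X")
    case True
    then show ?thesis using h' by (auto simp: coloured_emb_def)
  next
    case False
    then have r: "f (Inr (R, map h' is)) = (if is \<in> intp D R then 1 else 0)"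
      using rel t by blast
    have tup: "(R, map h' is) \<in> tuples L {1..n}" and sub: "set is \<subseteq> univ D" and R: "R \<in> syms L"
      using t ran by (auto simp: tuples_def)
    have "nonmono (conf_col n f) (map h' is)" if "is \<in> intp D R"
      using nonmono_if_colouring[OF \<gamma> R that] sub cc by (auto simp: nonmono_def subset_iff)
    then show ?thesis using r tup by (auto simp: conf_rel_def nonmono_tuples_def)
  qed
  then show ?thesis using inj ran col' by (auto simp: coloured_emb_def)
qed

text \<open>The points outside the image of \<open>h\<close> are cut into disjoint blocks of size \<open>d\<close>.  Whether a block
  extends \<open>h\<close> to an embedding of \<open>D\<close> is decided by at most \<open>N\<close> coordinates of the configuration, each
  touching the block, so different blocks are independent.\<close>

lemma card_nonextendable:
  assumes fin: "finite (syms L)" and l: "l \<ge> 2" and finD: "finite (univ D)"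
    and X: "X \<subset> univ D" and \<gamma>: "\<gamma> \<in> colourings l L D"
    and d: "d = card (univ D - X)" and N: "N = d + card (tuples L (univ D))"
    and h: "h \<in> X \<rightarrow>\<^sub>E {1..n}" "inj_on h X"
  shows "real (card {f \<in> configs l L n. coloured_emb L D \<gamma> n f X h \<and>
      \<not> (\<exists>h'. (\<forall>i\<in>X. h' i = h i) \<and> coloured_emb L D \<gamma> n f (univ D) h')})
    \<le> (1 - 1 / real l ^ N) ^ ((n - card X) div d) * real (card (configs l L n))"
proof -
  have d1: "d \<ge> 1" using X finD unfolding d by
    (metis Diff_eq_empty_iff One_nat_def Suc_leI card_gt_0_iff finite_Diff psubset_eq subset_antisym)
  have finX: "finite X" using finD X by (meson finite_subset psubset_imp_subset)
  define V where "V = {1..n} - h ` X"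
  define m where "m = (n - card X) div d"
  have cV: "card V = n - card X"
    unfolding V_def using h by (subst card_Diff_subset) (use finX in \<open>auto simp: card_image\<close>)
  \<comment> \<open>Block \<open>k\<close> will consist of the \<open>d\<close> points of
    \<open>V\<close> that \<open>e\<close> numbers from \<open>k * d\<close> on.\<close>
  obtain e where e: "bij_betw e {0..<card V} V"
    using ex_bij_betw_nat_finite[of V] by (auto simp: V_def)
  obtain idx where idx: "bij_betw idx {0..<d} (univ D - X)"
    using ex_bij_betw_nat_finite[of "univ D - X"] finD by (auto simp: d)
  define pos where "pos = inv_into {0..<d} idx"
  define num where "num = inv_into {0..<card V} e"
  have pos: "pos i < d" "idx (pos i) = i" if "i \<in> univ D - X" for i
    using that idx bij_betw_inv_into[OF idx] bij_betw_inv_into_right[OF idx]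
    by (auto simp: pos_def bij_betw_def)
  have idxin: "idx j \<in> univ D - X" if "j < d" for j
    using idx that by (auto simp: bij_betw_def)
  have num: "num (e j) = j" if "j < card V" for j
    using bij_betw_inv_into_left[OF e] that by (simp add: num_def)
  have ein: "e j \<in> V" if "j < card V" for j
    using e that by (auto simp: bij_betw_def)
  \<comment> \<open>\<open>H k\<close> extends \<open>h\<close> by sending the new points of
    \<open>D\<close> to block \<open>k\<close>, in the order fixed by \<open>idx\<close>.\<close>
  define H where "H k i = (if i \<in> X then h i else e (k * d + pos i))" for k i
  \<comment> \<open>A left inverse of all \<open>H k\<close> with k < m at once: reducing modulo
    \<open>d\<close> forgets the block. Hence a single target \<open>g\<close> can serve every
    block.\<close>
  define \<psi> where "\<psi> v = (if v \<in> h ` X then inv_into X h v else idx (num v mod d))" for v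
  have lt: "k * d + pos i < card V" if "k < m" "i \<in> univ D - X" for k i
  proof -
    have "k * d + pos i < Suc k * d" using pos(1)[OF that(2)] by simp
    also have "\<dots> \<le> m * d" using that(1) by (intro mult_le_mono1) simp
    also have "\<dots> \<le> card V" unfolding m_def cV by simp
    finally show ?thesis .
  qed
  have HV: "H k i \<in> V" "num (H k i) = k * d + pos i" if "k < m" "i \<in> univ D - X" for k i
    using lt[OF that] that ein num by (auto simp: H_def)
  have HX: "H k i = h i" if "i \<in> X" for k i using that by (simp add: H_def)
  have \<psi>H: "\<psi> (H k i) = i" if "k < m" "i \<in> univ D" for k i
  proof (cases "i \<in> X")
    case True
    then show ?thesis using h by (simp add: H_def \<psi>_def)
  next
    case False
    then have i: "i \<in> univ D - X" using that by simp
    then have "H k i \<notin> h ` X" using HV[OF that(1)] by (auto simp: V_def)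
    then show ?thesis using HV(2)[OF that(1) i] pos[OF i] by (simp add: \<psi>_def)
  qed
  have \<psi>D: "\<psi> v \<in> univ D" for v
  proof (cases "v \<in> h ` X")
    case True
    then have "\<psi> v \<in> X" by (simp add: \<psi>_def inv_into_into)
    then show ?thesis using X by blast
  next
    case False
    then show ?thesis using idxin[of "num v mod d"] d1 by (simp add: \<psi>_def)
  qed
  have Hran: "H k i \<in> {1..n}" if "k < m" "i \<in> univ D" for k i
    using HV(1)[OF that(1), of i] h HX[of i k] that by (cases "i \<in> X") (auto simp: V_def)
  \<comment> \<open>The coordinates that \<open>H k\<close> still has to get right: the colours of
    the new points and the bits of the tuples containing a new point.\<close>
  define J where "J k = Inl ` H k ` (univ D - X) \<union>
     (\<lambda>(R, is). Inr (R, map (H k) is)) ` (tuples L (univ D) - tuples L X)" for k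
  define g where "g x = (case x of Inl v \<Rightarrow> \<gamma> (\<psi> v)
     | Inr (R, as) \<Rightarrow> if map \<psi> as \<in> intp D R then 1 else 0)" for x
  have g: "g x \<in> vals l x" if "x \<in> index L n" for x
    using that \<gamma> \<psi>D by (auto simp: index_def g_def vals_def colourings_def PiE_iff)
  have Jsub: "J k \<subseteq> index L n" if k: "k < m" for k
  proof -
    have "(R, map (H k) is) \<in> tuples L {1..n}" if "(R, is) \<in> tuples L (univ D)" for R "is"
      using that Hran[OF k] by (auto simp: tuples_def simp del: atLeastAtMost_iff)
    moreover have "H k ` (univ D - X) \<subseteq> {1..n}" using Hran[OF k] by blast
    ultimately show ?thesis by (auto simp: J_def index_def simp del: atLeastAtMost_iff)
  qed
  \<comment> \<open>Division by \<open>d\<close> recovers the block number from a point outside the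
    image of \<open>h\<close>.\<close>
  have same: "k = k'" if k: "k < m" "k' < m" and i: "i \<in> univ D - X" and i': "i' \<in> univ D"
    and eq: "H k i = H k' i'" for k k' i i'
  proof -
    have "i' \<notin> X" using HV(1)[OF k(1) i] HX[of i' k'] eq by (auto simp: V_def)
    then have i': "i' \<in> univ D - X" using i' by simp
    have "k * d + pos i = k' * d + pos i'"
      using HV(2)[OF k(1) i] HV(2)[OF k(2) i'] eq by simp
    then have "(k * d + pos i) div d = (k' * d + pos i') div d" by simp
    then show "k = k'" using pos(1)[OF i] pos(1)[OF i'] d1 by simp
  qed
  have disj: "J k \<inter> J k' = {}" if k: "k < m" "k' < m" "k \<noteq> k'" for k k'
  proof (rule ccontr)
    assume "J k \<inter> J k' \<noteq> {}"
    then obtain x where x: "x \<in> J k" "x \<in> J k'" by blast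
    show False
    proof (cases x)
      case (Inl v)
      then obtain i i' where "i \<in> univ D - X" "i' \<in> univ D - X" "H k i = H k' i'"
        using x by (auto simp: J_def)
      then show False using same[OF k(1,2)] k(3) by blast
    next
      case (Inr p)
      then obtain R "is" R' is' where t: "(R, is) \<in> tuples L (univ D) - tuples L X"
        "(R', is') \<in> tuples L (univ D) - tuples L X" "map (H k) is = map (H k') is'"
        using x by (auto simp: J_def)
      \<comment> \<open>A tuple not inside \<open>X\<close> has an entry outside \<open>X\<close>,
        whose image lies in block \<open>k\<close>. This separates the blocks although their tuples
        may share points of the image of \<open>h\<close>.\<close>
      then obtain i where i: "i \<in> set is" "i \<in> univ D - X" by (auto simp: tuples_def)
      then have "H k i \<in> set (map (H k') is')" using t(3) by (metis image_eqI set_map)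
      then obtain i' where "i' \<in> set is'" "H k i = H k' i'" by auto
      moreover from this t(2) have "i' \<in> univ D" by (auto simp: tuples_def)
      ultimately show False using same[OF k(1,2) i(2)] k(3) by blast
    qed
  qed
  have cardJ: "card (J k) \<le> N" for k
  proof -
    have ft: "finite (tuples L (univ D))" using fin finD by (rule finite_tuples)
    have "card (J k) \<le> card (Inl ` H k ` (univ D - X) :: (nat + 'a \<times> nat list) set)
      + card ((\<lambda>(R, is). Inr (R, map (H k) is)) ` (tuples L (univ D) - tuples L X) :: (nat + 'a \<times> nat list) set)"
      unfolding J_def by (rule card_Un_le)
    also have "\<dots> \<le> card (univ D - X) + card (tuples L (univ D) - tuples L X)"
      using finD ft by (intro add_mono order.trans[OF card_image_le[OF finite_imageI] card_image_le] card_image_le) auto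
    also have "\<dots> \<le> N" unfolding N d using ft by (intro add_left_mono card_mono) auto
    finally show ?thesis .
  qed
  \<comment> \<open>A coordinate has \<open>l\<close> or 2 values, and \<open>l \<ge> 2\<close>
    bounds both by \<open>l\<close>.\<close>
  have prodJ: "(\<Prod>x\<in>J k. real (card (vals l x))) \<le> real l ^ N" if "k < m" for k
  proof (rule prod_le_power)
    show "0 \<le> real (card (vals l x)) \<and> real (card (vals l x)) \<le> real l" for x :: "nat + 'a \<times> nat list"
      using l by (auto simp: vals_def split: sum.splits)
  qed (use cardJ l in auto)
  have "real (card {f \<in> PiE (index L n) (vals l). \<forall>k<m. \<exists>x\<in>J k. f x \<noteq> g x})
    \<le> (1 - 1 / real l ^ N) ^ m * (\<Prod>x\<in>index L n. real (card (vals l x)))"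
    by (rule card_PiE_avoid) (use fin finite_index finite_vals g Jsub disj prodJ l in auto)
  also have "(\<Prod>x\<in>index L n. real (card (vals l x))) = real (card (configs l L n))"
    by (simp add: configs_def card_PiE finite_index fin)
  finally have main: "real (card {f \<in> PiE (index L n) (vals l). \<forall>k<m. \<exists>x\<in>J k. f x \<noteq> g x})
    \<le> (1 - 1 / real l ^ N) ^ m * real (card (configs l L n))" .
  \<comment> \<open>If \<open>f\<close> agrees with \<open>g\<close> on all of \<open>J k\<close>,
    then \<open>H k\<close> extends \<open>h\<close>; so failure to extend means a disagreement in
    every block.\<close>
  have "{f \<in> configs l L n. coloured_emb L D \<gamma> n f X h \<and>
      \<not> (\<exists>h'. (\<forall>i\<in>X. h' i = h i) \<and> coloured_emb L D \<gamma> n f (univ D) h')}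
    \<subseteq> {f \<in> PiE (index L n) (vals l). \<forall>k<m. \<exists>x\<in>J k. f x \<noteq> g x}"
  proof (intro subsetI, elim CollectE conjE, intro CollectI conjI allI impI, simp add: configs_def, rule ccontr)
    fix f k
    assume f: "f \<in> configs l L n" and emb: "coloured_emb L D \<gamma> n f X h"
      and no: "\<not> (\<exists>h'. (\<forall>i\<in>X. h' i = h i) \<and> coloured_emb L D \<gamma> n f (univ D) h')"
      and k: "k < m" and "\<not> (\<exists>x\<in>J k. f x \<noteq> g x)"
    then have eq: "f x = g x" if "x \<in> J k" for x using that by blast
    have "coloured_emb L D \<gamma> n f (univ D) (H k)"
    proof (rule coloured_emb_extend[OF \<gamma> _ emb])
      show "X \<subseteq> univ D" using X by blast
      show "inj_on (H k) (univ D)" using \<psi>H[OF k] by (rule inj_on_inverseI)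
      show "H k ` univ D \<subseteq> {1..n}" using Hran[OF k] by blast
      show "f (Inl (H k i)) = \<gamma> i" if "i \<in> univ D - X" for i
      proof -
        have "Inl (H k i) \<in> J k" using that by (auto simp: J_def)
        from eq[OF this] show ?thesis using \<psi>H[OF k, of i] that by (simp add: g_def)
      qed
      show "f (Inr (R, map (H k) is)) = (if is \<in> intp D R then 1 else 0)"
        if t: "(R, is) \<in> tuples L (univ D) - tuples L X" for R "is"
      proof -
        have "Inr (R, map (H k) is) \<in> J k" using t by (force simp: J_def)
        moreover have "map \<psi> (map (H k) is) = is"
          using t \<psi>H[OF k] by (auto simp: tuples_def subset_iff intro!: map_idI)
        ultimately show ?thesis using eq by (simp add: g_def del: map_map)
      qed
    qed (simp add: HX)
    then show False using no HX by blast
  qed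
  then have "card {f \<in> configs l L n. coloured_emb L D \<gamma> n f X h \<and>
      \<not> (\<exists>h'. (\<forall>i\<in>X. h' i = h i) \<and> coloured_emb L D \<gamma> n f (univ D) h')}
    \<le> card {f \<in> PiE (index L n) (vals l). \<forall>k<m. \<exists>x\<in>J k. f x \<noteq> g x}"
    using finite_configs[OF fin, of l n] by (intro card_mono) (auto simp: configs_def)
  then show ?thesis using main unfolding m_def by linarith
qed

text \<open>Union bound: at most \<open>n ^ card X\<close> maps \<open>h\<close> have to be
  considered, and each fails to extend with exponentially small probability because the number of
  blocks grows linearly in \<open>n\<close>.\<close>

lemma tendsto_not_all_extend:
  assumes fin: "finite (syms L)" and l: "l \<ge> 2" and finD: "finite (univ D)"
    and X: "X \<subset> univ D" and \<gamma>: "\<gamma> \<in> colourings l L D"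
  shows "(\<lambda>n. real (card {f \<in> configs l L n. \<not> all_extend L D \<gamma> X n f}) / real (card (configs l L n)))
    \<longlonglongrightarrow> 0"
proof -
  define d where "d = card (univ D - X)"
  define N where "N = d + card (tuples L (univ D))"
  define x where "x = 1 - 1 / real l ^ N"
  have finX: "finite X" using finD X by (meson finite_subset psubset_imp_subset)
  have d1: "d \<ge> 1" using X finD unfolding d_def by
    (metis Diff_eq_empty_iff One_nat_def Suc_leI card_gt_0_iff finite_Diff psubset_eq subset_antisym)
  have x: "0 \<le> x" "x < 1" using l by (simp_all add: x_def)
  have cc: "real (card (configs l L n)) > 0" for n using l by (simp add: card_configs[OF fin])
  have "real (card {f \<in> configs l L n. \<not> all_extend L D \<gamma> X n f})
    \<le> real n ^ card X * x ^ ((n - card X) div d) * real (card (configs l L n))" for n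
  proof -
    define A where "A h = {f \<in> configs l L n. coloured_emb L D \<gamma> n f X h \<and>
      \<not> (\<exists>h'. (\<forall>i\<in>X. h' i = h i) \<and> coloured_emb L D \<gamma> n f (univ D) h')}" for h
    let ?Hs = "X \<rightarrow>\<^sub>E {1..n}"
    have finH: "finite ?Hs" using finX by (simp add: finite_PiE)
    have "{f \<in> configs l L n. \<not> all_extend L D \<gamma> X n f} \<subseteq> (\<Union>h\<in>?Hs. A h)"
    proof
      fix f assume "f \<in> {f \<in> configs l L n. \<not> all_extend L D \<gamma> X n f}"
      then obtain h where f: "f \<in> configs l L n" and h: "coloured_emb L D \<gamma> n f X h"
        and no: "\<not> (\<exists>h'. (\<forall>i\<in>X. h' i = h i) \<and> coloured_emb L D \<gamma> n f (univ D) h')"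
        by (auto simp: all_extend_def)
      \<comment> \<open>Only the values on \<open>X\<close> matter, so the finitely many extensional
        maps suffice.\<close>
      have "coloured_emb L D \<gamma> n f X (restrict h X)"
        using h by (rule coloured_emb_cong) simp
      moreover have "restrict h X \<in> ?Hs" using h by (auto simp: coloured_emb_def)
      moreover have "\<not> (\<exists>h'. (\<forall>i\<in>X. h' i = restrict h X i) \<and> coloured_emb L D \<gamma> n f (univ D) h')"
        using no by simp
      ultimately have "f \<in> A (restrict h X)" "restrict h X \<in> ?Hs" using f by (simp_all add: A_def)
      then show "f \<in> (\<Union>h\<in>?Hs. A h)" by (rule UN_I[rotated])
    qed
    then have "card {f \<in> configs l L n. \<not> all_extend L D \<gamma> X n f} \<le> card (\<Union>h\<in>?Hs. A h)"
      using finH finite_configs[OF fin] by (intro card_mono finite_UN_I) (simp_all add: A_def)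
    also have "\<dots> \<le> (\<Sum>h\<in>?Hs. card (A h))" using finH by (rule card_UN_le)
    finally have "real (card {f \<in> configs l L n. \<not> all_extend L D \<gamma> X n f}) \<le> (\<Sum>h\<in>?Hs. real (card (A h)))"
      by (simp flip: of_nat_sum)
    also have "\<dots> \<le> (\<Sum>h\<in>?Hs. x ^ ((n - card X) div d) * real (card (configs l L n)))"
    proof (rule sum_mono)
      fix h assume h: "h \<in> ?Hs"
      show "real (card (A h)) \<le> x ^ ((n - card X) div d) * real (card (configs l L n))"
      proof (cases "inj_on h X")
        case True
        then show ?thesis
          using card_nonextendable[OF fin l finD X \<gamma> d_def N_def h] by (simp add: A_def x_def)
      next
        case False
        \<comment> \<open>A map that is not injective is no embedding, so there is nothing to
          extend.\<close>
        then have "A h = {}" by (simp add: A_def coloured_emb_def)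
        then show ?thesis using x by simp
      qed
    qed
    also have "\<dots> = real n ^ card X * x ^ ((n - card X) div d) * real (card (configs l L n))"
      using finX by (simp add: card_PiE)
    finally show ?thesis .
  qed
  then have le: "real (card {f \<in> configs l L n. \<not> all_extend L D \<gamma> X n f}) / real (card (configs l L n))
    \<le> real n ^ card X * x ^ ((n - card X) div d)" for n
    using cc[of n] by (simp add: divide_le_eq)
  show ?thesis
    by (rule tendsto_sandwich[OF _ _ tendsto_const poly_times_geometric_tendsto_0[OF x d1, where k = "card X" and j = "card X"]])
      (use le in auto)
qed

section \<open>The extension axioms\<close>

lemma sat_Exs:
  "sat M e (Exs xs p) \<longleftrightarrow>
     (\<exists>h. (\<forall>x\<in>set xs. h x \<in> univ M) \<and> sat M (\<lambda>x. if x \<in> set xs then h x else e x) p)"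
proof (induction xs arbitrary: e)
  case (Cons a xs)
  show ?case
  proof
    assume "sat M e (Exs (a # xs) p)"
    then obtain v where "v \<in> univ M" "sat M (e(a := v)) (Exs xs p)" by auto
    then obtain h where h: "\<forall>x\<in>set xs. h x \<in> univ M"
      "sat M (\<lambda>x. if x \<in> set xs then h x else (e(a := v)) x) p" unfolding Cons.IH by blast
    \<comment> \<open>If \<open>a\<close> occurs again in \<open>xs\<close>, the inner quantifier
      overrides the outer one.\<close>
    define h' where "h' x = (if x \<in> set xs then h x else v)" for x
    have "(\<lambda>x. if x \<in> set xs then h x else (e(a := v)) x) = (\<lambda>x. if x \<in> set (a # xs) then h' x else e x)"
      by (auto simp: h'_def)
    then show "\<exists>h. (\<forall>x\<in>set (a # xs). h x \<in> univ M) \<and> sat M (\<lambda>x. if x \<in> set (a # xs) then h x else e x) p"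
      using h \<open>v \<in> univ M\<close> by (intro exI[of _ h']) (auto simp: h'_def)
  next
    assume "\<exists>h. (\<forall>x\<in>set (a # xs). h x \<in> univ M) \<and> sat M (\<lambda>x. if x \<in> set (a # xs) then h x else e x) p"
    then obtain h where h: "\<forall>x\<in>set (a # xs). h x \<in> univ M"
      "sat M (\<lambda>x. if x \<in> set (a # xs) then h x else e x) p" by blast
    have "(\<lambda>x. if x \<in> set (a # xs) then h x else e x) = (\<lambda>x. if x \<in> set xs then h x else (e(a := h a)) x)"
      by auto
    then have "sat M (e(a := h a)) (Exs xs p)" unfolding Cons.IH using h by (intro exI[of _ h]) auto
    then show "sat M e (Exs (a # xs) p)" using h by auto
  qed
qed simp

lemma sat_Alls:
  "sat M e (Alls xs p) \<longleftrightarrow>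
     (\<forall>h. (\<forall>x\<in>set xs. h x \<in> univ M) \<longrightarrow> sat M (\<lambda>x. if x \<in> set xs then h x else e x) p)"
proof -
  have "sat M e (Alls xs p) \<longleftrightarrow> \<not> sat M e (Exs xs (Neg p))"
    by (induction xs arbitrary: e) simp_all
  then show ?thesis unfolding sat_Exs sat.simps by blast
qed

section \<open>Defining equality of colours by \<open>xi\<close>\<close>

abbreviation conf_red :: "'r lang \<Rightarrow> nat \<Rightarrow> (nat + 'r \<times> nat list \<Rightarrow> nat) \<Rightarrow> ('r, nat) struct" where
  "conf_red L n f \<equiv> reduct (conf_struct L n f)"

lemma conf_red_sel [simp]:
  "univ (conf_red L n f) = {1..n}" "intp (conf_red L n f) R = {as. (R, as) \<in> conf_rel L n f}"
  by (simp_all add: reduct_def conf_struct_def)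

lemma sat_chi_conf:
  assumes "finite (syms L)" "finite (univ D)"
  shows "sat (conf_red L n f) e (chi L D v) \<longleftrightarrow> inj_on (\<lambda>i. e (v i)) (univ D) \<and>
    (\<forall>(R, is)\<in>tuples L (univ D). (R, map (\<lambda>i. e (v i)) is) \<in> conf_rel L n f \<longleftrightarrow> is \<in> intp D R)"
  unfolding sat_chi_iff[OF assms] by (simp add: tuples_def)

text \<open>The values of the bound \<open>Wv\<close> variables and of \<open>y\<close> and
  \<open>z\<close> are assembled into one map \<open>a\<close> on the universe of \<open>S\<close>;
  the side conditions on \<open>y\<close> and \<open>z\<close> exclude capture.\<close>

lemma sat_xi_conf:
  assumes fin: "finite (syms L)" and S: "univ S = {1..s}" "s \<ge> 3"
    and yz: "y \<notin> range Wv" "z \<notin> range Wv" and e: "e y \<in> {1..n}" "e z \<in> {1..n}"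
  shows "sat (conf_red L n f) e (xi L S y z) \<longleftrightarrow> e y = e z \<or>
    (\<exists>a. a (s - 1) = e y \<and> a s = e z \<and> a ` {1..s} \<subseteq> {1..n} \<and> inj_on a {1..s} \<and>
      (\<forall>(R, is)\<in>tuples L {1..s}. (R, map a is) \<in> conf_rel L n f \<longleftrightarrow> is \<in> intp S R))"
    (is "_ \<longleftrightarrow> _ \<or> ?E")
proof -
  let ?W = "set (map Wv [1..<s - 1])"
  let ?v = "\<lambda>i. if i = s - 1 then y else if i = s then z else Wv i"
  have finS: "finite (univ S)" and cs: "card (univ S) = s" using S by simp_all
  have "sat (conf_red L n f) e (xi L S y z) \<longleftrightarrow> e y = e z \<or>
    (\<exists>h. (\<forall>x\<in>?W. h x \<in> {1..n}) \<and>
      sat (conf_red L n f) (\<lambda>x. if x \<in> ?W then h x else e x) (chi L S ?v))" (is "_ \<longleftrightarrow> _ \<or> ?F")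
    unfolding xi_def Let_def cs sat_derived sat.simps sat_Exs conf_red_sel(1) by (rule refl)
  also have "?F \<longleftrightarrow> ?E"
  proof
    assume ?F
    then obtain h where h: "\<forall>x\<in>?W. h x \<in> {1..n}"
      and sat: "sat (conf_red L n f) (\<lambda>x. if x \<in> ?W then h x else e x) (chi L S ?v)" by blast
    define a where "a i = (if ?v i \<in> ?W then h (?v i) else e (?v i))" for i
    have "y \<notin> ?W" "z \<notin> ?W" using yz by auto
    then have a: "a (s - 1) = e y" "a s = e z" using S(2) by (auto simp: a_def)
    have "a i \<in> {1..n}" if i: "i \<in> {1..s}" for i
    proof (cases "i = s - 1 \<or> i = s")
      case True
      then show ?thesis using a e by metis
    next
      case False
      then have "Wv i \<in> ?W" using i by auto
      moreover from this have "h (Wv i) \<in> {1..n}" using h by blast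
      ultimately show ?thesis using False by (simp add: a_def)
    qed
    then have "a ` {1..s} \<subseteq> {1..n}" by blast
    moreover have "inj_on a {1..s} \<and>
      (\<forall>(R, is)\<in>tuples L {1..s}. (R, map a is) \<in> conf_rel L n f \<longleftrightarrow> is \<in> intp S R)"
      using sat unfolding sat_chi_conf[OF fin finS] S(1) a_def .
    ultimately show ?E using a by blast
  next
    assume ?E
    then obtain a where a: "a (s - 1) = e y" "a s = e z" "a ` {1..s} \<subseteq> {1..n}"
      and emb: "inj_on a {1..s}"
        "\<forall>(R, is)\<in>tuples L {1..s}. (R, map a is) \<in> conf_rel L n f \<longleftrightarrow> is \<in> intp S R" by blast
    \<comment> \<open>Only \<open>Wv\<close> variables are reassigned, so the default 0 is never
      read.\<close>
    define h where "h x = (case x of Wv i \<Rightarrow> a i | _ \<Rightarrow> 0)" for x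
    define b where "b i = (if ?v i \<in> ?W then h (?v i) else e (?v i))" for i
    have "y \<notin> ?W" "z \<notin> ?W" using yz by auto
    then have b: "b i = a i" if "i \<in> {1..s}" for i
      using that a(1,2) by (auto simp: b_def h_def)
    have hW: "\<forall>x\<in>?W. h x \<in> {1..n}"
    proof
      fix x assume "x \<in> ?W"
      then obtain i where i: "x = Wv i" "i \<in> {1..s}" by auto
      then have "a i \<in> {1..n}" using a(3) by blast
      then show "h x \<in> {1..n}" by (simp add: i(1) h_def)
    qed
    have "inj_on b {1..s}" using emb(1) inj_on_cong[of "{1..s}" a b] b by simp
    moreover have "\<forall>(R, is)\<in>tuples L {1..s}. (R, map b is) \<in> conf_rel L n f \<longleftrightarrow> is \<in> intp S R"
    proof (intro ballI, clarify)
      fix R "is" assume t: "(R, is) \<in> tuples L {1..s}"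
      have m: "map b is = map a is" using t b by (auto simp: tuples_def)
      show "(R, map b is) \<in> conf_rel L n f \<longleftrightarrow> is \<in> intp S R" unfolding m using emb(2) t by blast
    qed
    ultimately have "sat (conf_red L n f) (\<lambda>x. if x \<in> ?W then h x else e x) (chi L S ?v)"
      unfolding sat_chi_conf[OF fin finS] S(1) b_def by blast
    then show ?F using hW by blast
  qed
  finally show ?thesis .
qed

text \<open>A copy of \<open>S\<close> pulls the colours back to a colouring of \<open>S\<close>,
  and every such colouring agrees on \<open>s - 1\<close> and \<open>s\<close>. Conversely, two
  distinct points of colour i are the image of these two points under a colouring of
  \<open>S\<close> giving both the colour i, and the extension property completes the copy.\<close>

lemma sat_xi_iff_same_colour:
  assumes fin: "finite (syms L)" and same: "same_colour_structure l L S"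
    and S: "univ S = {1..s}" and f: "f \<in> configs l L n"
    and ext: "\<And>\<gamma>. \<gamma> \<in> colourings l L S \<Longrightarrow> all_extend L S \<gamma> {s - 1, s} n f"
    and yz: "y \<notin> range Wv" "z \<notin> range Wv" and e: "e y \<in> {1..n}" "e z \<in> {1..n}"
  shows "sat (conf_red L n f) e (xi L S y z) \<longleftrightarrow> f (Inl (e y)) = f (Inl (e z))"
proof -
  obtain s' where str: "is_struct L S" and s': "s' \<ge> 3" "univ S = {1..s'}"
    and eq': "\<forall>\<gamma>\<in>colourings l L S. \<gamma> (s' - 1) = \<gamma> s'"
    and ex': "\<forall>i\<in>{1..l}. \<exists>\<gamma>\<in>colourings l L S. \<gamma> (s' - 1) = i \<and> \<gamma> s' = i"
    using same unfolding same_colour_structure_def by blast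
  have "s' = s" using S s' by auto
  note s = s'(1)[unfolded this] and eq = eq'[unfolded this] and ex = ex'[unfolded this]
  have col: "f (Inl v) \<in> {1..l}" if "v \<in> {1..n}" for v
    using f that by (force simp: configs_def index_def vals_def PiE_iff)
  note xi = sat_xi_conf[where e = e and f = f, OF fin S s yz e]
  show ?thesis
  proof
    assume "sat (conf_red L n f) e (xi L S y z)"
    then consider "e y = e z" | a where "a (s - 1) = e y" "a s = e z" "a ` {1..s} \<subseteq> {1..n}"
      "\<forall>(R, is)\<in>tuples L {1..s}. (R, map a is) \<in> conf_rel L n f \<longleftrightarrow> is \<in> intp S R"
      unfolding xi by (elim disjE exE conjE)
    then show "f (Inl (e y)) = f (Inl (e z))"
    proof cases
      case (2 a)
      \<comment> \<open>The colouring pulled back along the copy \<open>a\<close> of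
        \<open>S\<close>.\<close>
      define \<gamma> where "\<gamma> = (\<lambda>i\<in>{1..s}. f (Inl (a i)))"
      have "\<gamma> \<in> colourings l L S"
      proof (rule colouringI)
        show "\<gamma> \<in> univ S \<rightarrow>\<^sub>E {1..l}"
          unfolding S \<gamma>_def using 2(3) col by (intro restrict_PiE_iff[THEN iffD2] ballI) blast
      next
        fix R "is" assume R: "R \<in> syms L" "is \<in> intp S R"
        then have t: "(R, is) \<in> tuples L {1..s}" using str S by (auto simp: is_struct_def tuples_def)
        then have "(R, map a is) \<in> conf_rel L n f" using 2(4) R(2) by blast
        then have "nonmono (conf_col n f) (map a is)" by (auto simp: conf_rel_def nonmono_tuples_def)
        moreover have "conf_col n f (a i) = \<gamma> i" if "i \<in> set is" for i
        proof -
          have "i \<in> {1..s}" using that t by (auto simp: tuples_def)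
          moreover from this have "a i \<in> {1..n}" using 2(3) by blast
          ultimately show ?thesis by (simp add: conf_col_def \<gamma>_def)
        qed
        ultimately show "nonmono \<gamma> is" by (simp add: nonmono_def)
      qed
      then have "\<gamma> (s - 1) = \<gamma> s" using eq by blast
      moreover have "s - 1 \<in> {1..s}" "s \<in> {1..s}" using s by auto
      ultimately show ?thesis using 2(1,2) unfolding \<gamma>_def by (metis restrict_apply')
    qed simp
  next
    assume same: "f (Inl (e y)) = f (Inl (e z))"
    show "sat (conf_red L n f) e (xi L S y z)"
    proof (cases "e y = e z")
      case True
      then show ?thesis unfolding xi by simp
    next
      case False
      obtain \<gamma> where \<gamma>: "\<gamma> \<in> colourings l L S" "\<gamma> (s - 1) = f (Inl (e y))" "\<gamma> s = f (Inl (e y))"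
        using ex col[OF e(1)] by blast
      define h where "h i = (if i = s then e z else e y)" for i
      have h: "h (s - 1) = e y" "h s = e z" using s by (auto simp: h_def)
      have "coloured_emb L S \<gamma> n f {s - 1, s} h"
        unfolding coloured_emb_def
      proof (intro conjI)
        show "inj_on h {s - 1, s}" using False h by (auto simp: inj_on_def)
        show "h ` {s - 1, s} \<subseteq> {1..n}" using e h by auto
        show "\<forall>i\<in>{s - 1, s}. f (Inl (h i)) = \<gamma> i" using \<gamma> h same by auto
        \<comment> \<open>Tuples over these two points are monochromatic on both sides, so none is
          related in \<open>S\<close> or in the configuration's structure.\<close>
        show "\<forall>(R, is)\<in>tuples L {s - 1, s}. (R, map h is) \<in> conf_rel L n f \<longleftrightarrow> is \<in> intp S R"
        proof (intro ballI, clarify)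
          fix R "is" assume t: "(R, is) \<in> tuples L {s - 1, s}"
          have mem: "i = s - 1 \<or> i = s" if "i \<in> set is" for i
            using that t by (auto simp: tuples_def)
          have "\<gamma> i = f (Inl (e y))" if "i \<in> set is" for i
            using mem[OF that] \<gamma>(2,3) by metis
          then have "\<not> nonmono \<gamma> is" by (simp add: nonmono_def)
          then have 1: "is \<notin> intp S R" using nonmono_if_colouring[OF \<gamma>(1)] t by (auto simp: tuples_def)
          have "conf_col n f (h i) = f (Inl (e y))" if "i \<in> set is" for i
          proof -
            have "h i = e y \<or> h i = e z" using mem[OF that] h by metis
            then show ?thesis using e same by (auto simp: conf_col_def)
          qed
          then have "\<not> nonmono (conf_col n f) (map h is)" by (simp add: nonmono_def)
          then have "(R, map h is) \<notin> conf_rel L n f" by (auto simp: conf_rel_def nonmono_tuples_def)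
          with 1 show "(R, map h is) \<in> conf_rel L n f \<longleftrightarrow> is \<in> intp S R" by simp
        qed
      qed
      with ext[OF \<gamma>(1)] obtain a where a: "\<forall>i\<in>{s - 1, s}. a i = h i"
        "coloured_emb L S \<gamma> n f (univ S) a" unfolding all_extend_def by blast
      then have "a (s - 1) = e y" "a s = e z" using h by auto
      then show ?thesis using a(2) unfolding xi coloured_emb_def S by blast
    qed
  qed
qed

text \<open>By \<open>zeta\<close> the first \<open>l\<close> of the \<open>Xv\<close> values have
  distinct colours, so renaming the colours of \<open>\<gamma>'\<close> accordingly gives a
  colouring of \<open>B\<close> that the given copy of \<open>A\<close> respects. Its extension to
  \<open>B\<close> supplies the new points, and \<open>xi\<close> translates their colours back into
  \<open>theta\<close>.\<close>

lemma sat_ext_instance: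
  assumes fin: "finite (syms L)" and same: "same_colour_structure l L S" and S: "univ S = {1..s}"
    and U: "univ U = {1..u}" "l \<le> u" and c: "inj_on c {1..l}"
    and A: "A = substr B {1..\<alpha>}" and B: "univ B = {1..\<beta>}" and \<alpha>: "\<alpha> < \<beta>"
    and strB: "is_struct L B"
    and \<gamma>': "\<gamma>' \<in> colourings l L B" and \<tau>: "\<tau> permutes {1..l}"
    and f: "f \<in> configs l L n"
    and extS: "\<And>\<gamma>. \<gamma> \<in> colourings l L S \<Longrightarrow> all_extend L S \<gamma> {s - 1, s} n f"
    and extB: "\<And>\<gamma>. \<gamma> \<in> colourings l L B \<Longrightarrow> all_extend L B \<gamma> {1..\<alpha>} n f"
    and e: "range e \<subseteq> {1..n}"
  shows "sat (conf_red L n f) e (ext_instance L S U c A B \<gamma>' \<tau>)"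
proof -
  let ?M = "conf_red L n f"
  define P where "P = And (zeta L S U c) (And (chi L A Yv) (theta L S (univ A) (restrict \<gamma>' (univ A)) \<tau>))"
  define Q where "Q = And (chi L B Yv) (theta L S (univ B) \<gamma>' \<tau>)"
  have uA: "univ A = {1..\<alpha>}" by (simp add: A substr_def)
  have iA: "intp A R = {as \<in> intp B R. set as \<subseteq> {1..\<alpha>}}" for R by (simp add: A substr_def)
  have inst: "ext_instance L S U c A B \<gamma>' \<tau>
    = Alls (map Xv [1..<u + 1] @ map Yv [1..<\<alpha> + 1]) (Exs (map Yv [\<alpha> + 1..<\<beta> + 1]) (Imp P Q))"
    unfolding ext_instance_def Let_def P_def Q_def uA U(1) B by simp
  have xi: "sat ?M e' (xi L S y z) \<longleftrightarrow> f (Inl (e' y)) = f (Inl (e' z))"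
    if "range e' \<subseteq> {1..n}" "y \<notin> range Wv" "z \<notin> range Wv" for e' y z
    by (rule sat_xi_iff_same_colour[OF fin same S f extS that(2,3)]) (use that(1) in blast)+
  have main: "sat ?M e1 (Exs (map Yv [\<alpha> + 1..<\<beta> + 1]) (Imp P Q))" if e1: "range e1 \<subseteq> {1..n}" for e1
  proof (cases "sat ?M e1 P")
    case False
    \<comment> \<open>When the premise fails, the quantified variables keep their values, so the
      assignment is unchanged and the implication vacuous.\<close>
    then have "sat ?M (\<lambda>x. if x \<in> set (map Yv [\<alpha> + 1..<\<beta> + 1]) then e1 x else e1 x) (Imp P Q)"
      by simp
    moreover have "\<forall>x\<in>set (map Yv [\<alpha> + 1..<\<beta> + 1]). e1 x \<in> univ ?M"
      unfolding conf_red_sel using e1 by blast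
    ultimately show ?thesis unfolding sat_Exs by blast
  next
    case True
    have finA: "finite (univ A)" by (simp add: uA)
    define col where "col x = f (Inl (e1 x))" for x
    have col: "col x \<in> {1..l}" for x
    proof -
      have "e1 x \<in> {1..n}" using e1 by blast
      then show ?thesis using f by (force simp: col_def configs_def index_def vals_def PiE_iff)
    qed
    have finIJ: "finite {(i, j). i \<in> univ U \<and> j \<in> univ U \<and> i < j \<and> c i \<noteq> c j}"
      by (rule finite_subset[of _ "univ U \<times> univ U"]) (auto simp: U)
    \<comment> \<open>Since \<open>c\<close> separates 1..l, \<open>zeta\<close> contains the
      negated \<open>xi\<close> for each of these pairs.\<close>
    have Xne: "col (Xv i) \<noteq> col (Xv j)" if "i \<in> {1..l}" "j \<in> {1..l}" "i < j" for i j
    proof -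
      have "c i \<noteq> c j" using inj_onD[OF c, of i j] that by auto
      then have "(i, j) \<in> {(i, j). i \<in> univ U \<and> j \<in> univ U \<and> i < j \<and> c i \<noteq> c j}"
        using that U by simp
      moreover have "\<forall>p\<in>{(i, j). i \<in> univ U \<and> j \<in> univ U \<and> i < j \<and> c i \<noteq> c j}.
          sat ?M e1 (case p of (i, j) \<Rightarrow> Neg (xi L S (Xv i) (Xv j)))"
        using True unfolding P_def zeta_def sat.simps sat_Conj[OF finIJ] by (elim conjE)
      ultimately have "sat ?M e1 (case (i, j) of (i, j) \<Rightarrow> Neg (xi L S (Xv i) (Xv j)))"
        by (rule bspec[rotated])
      then have "\<not> sat ?M e1 (xi L S (Xv i) (Xv j))" by simp
      moreover have "Xv i \<notin> range Wv" "Xv j \<notin> range Wv" by auto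
      ultimately show ?thesis using xi[OF e1] unfolding col_def by blast
    qed
    have Xinj: "inj_on (\<lambda>i. col (Xv i)) {1..l}"
    proof (rule inj_onI)
      fix i j assume *: "i \<in> {1..l}" "j \<in> {1..l}" "col (Xv i) = col (Xv j)"
      then show "i = j"
        using Xne[OF *(1,2)] Xne[OF *(2,1)] by (cases i j rule: linorder_cases) simp_all
    qed
    have Ycol: "col (Yv j) = col (Xv (\<tau> (\<gamma>' j)))" if "j \<in> {1..\<alpha>}" for j
    proof -
      have "sat ?M e1 (xi L S (Xv (\<tau> (restrict \<gamma>' (univ A) j))) (Yv j))"
        using True that unfolding P_def theta_def sat.simps uA sat_Conj[OF finite_atLeastAtMost] by blast
      moreover have "restrict \<gamma>' (univ A) j = \<gamma>' j" using that by (simp add: uA)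
      moreover have "Xv (\<tau> (\<gamma>' j)) \<notin> range Wv" "Yv j \<notin> range Wv" by auto
      ultimately show ?thesis using xi[OF e1] unfolding col_def by metis
    qed
    \<comment> \<open>The formula sees colours only up to renaming: \<open>\<delta>\<close> is
      \<open>\<gamma>'\<close> renamed by \<open>\<tau>\<close> and then by the actual colours of
      the \<open>Xv\<close> values.\<close>
    define \<delta> where "\<delta> = (\<lambda>j\<in>{1..\<beta>}. col (Xv (\<tau> (\<gamma>' j))))"
    have \<gamma>r: "\<gamma>' j \<in> {1..l}" if "j \<in> {1..\<beta>}" for j
      using \<gamma>' that unfolding colourings_def B by blast
    have \<tau>r: "\<tau> i \<in> {1..l}" if "i \<in> {1..l}" for i using that permutes_in_image[OF \<tau>] by blast
    \<comment> \<open>Both renamings are injective, so \<open>\<delta>\<close> has the colour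
      classes of \<open>\<gamma>'\<close> and is again a colouring.\<close>
    have \<delta>_iff: "\<delta> j = \<delta> k \<longleftrightarrow> \<gamma>' j = \<gamma>' k" if "j \<in> {1..\<beta>}" "k \<in> {1..\<beta>}" for j k
    proof -
      have "\<delta> j = \<delta> k \<longleftrightarrow> \<tau> (\<gamma>' j) = \<tau> (\<gamma>' k)"
        using that inj_on_eq_iff[OF Xinj \<tau>r[OF \<gamma>r[OF that(1)]] \<tau>r[OF \<gamma>r[OF that(2)]]] by (simp add: \<delta>_def)
      then show ?thesis using permutes_inj[OF \<tau>] by (simp add: inj_eq)
    qed
    have \<delta>: "\<delta> \<in> colourings l L B"
    proof (rule colouringI)
      show "\<delta> \<in> univ B \<rightarrow>\<^sub>E {1..l}" unfolding \<delta>_def B using col by (intro restrict_PiE_iff[THEN iffD2] ballI)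
    next
      fix R "is" assume R: "R \<in> syms L" "is \<in> intp B R"
      then have sub: "set is \<subseteq> {1..\<beta>}" using strB unfolding is_struct_def B by blast
      obtain i j where ij: "i \<in> set is" "j \<in> set is" "\<gamma>' i \<noteq> \<gamma>' j"
        using nonmono_if_colouring[OF \<gamma>' R] unfolding nonmono_def by blast
      then have "\<delta> i \<noteq> \<delta> j" using \<delta>_iff[OF subsetD[OF sub ij(1)] subsetD[OF sub ij(2)]] by simp
      then show "nonmono \<delta> is" unfolding nonmono_def using ij(1,2) by (intro bexI)
    qed
    have chiA: "inj_on (\<lambda>j. e1 (Yv j)) {1..\<alpha>}"
      "\<forall>(R, is)\<in>tuples L {1..\<alpha>}. (R, map (\<lambda>j. e1 (Yv j)) is) \<in> conf_rel L n f \<longleftrightarrow> is \<in> intp A R"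
      using True unfolding P_def sat.simps sat_chi_conf[OF fin finA] uA by blast+
    have "coloured_emb L B \<delta> n f {1..\<alpha>} (\<lambda>j. e1 (Yv j))"
      unfolding coloured_emb_def
    proof (intro conjI chiA(1))
      show "(\<lambda>j. e1 (Yv j)) ` {1..\<alpha>} \<subseteq> {1..n}" using e1 by blast
      show "\<forall>j\<in>{1..\<alpha>}. f (Inl (e1 (Yv j))) = \<delta> j"
      proof
        fix j assume j: "j \<in> {1..\<alpha>}"
        then show "f (Inl (e1 (Yv j))) = \<delta> j" using Ycol[OF j] \<alpha> by (simp add: \<delta>_def col_def)
      qed
      show "\<forall>(R, is)\<in>tuples L {1..\<alpha>}.
          (R, map (\<lambda>j. e1 (Yv j)) is) \<in> conf_rel L n f \<longleftrightarrow> is \<in> intp B R"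
      proof (intro ballI, clarify)
        fix R "is" assume t: "(R, is) \<in> tuples L {1..\<alpha>}"
        then have "is \<in> intp A R \<longleftrightarrow> is \<in> intp B R" unfolding iA tuples_def by simp
        then show "(R, map (\<lambda>j. e1 (Yv j)) is) \<in> conf_rel L n f \<longleftrightarrow> is \<in> intp B R"
          using chiA(2) t by blast
      qed
    qed
    with extB[OF \<delta>] obtain b where b: "\<forall>j\<in>{1..\<alpha>}. b j = e1 (Yv j)"
      "coloured_emb L B \<delta> n f {1..\<beta>} b" unfolding all_extend_def B by blast
    have b_inj: "inj_on b {1..\<beta>}" and b_ran: "b ` {1..\<beta>} \<subseteq> {1..n}"
      and b_col: "\<forall>j\<in>{1..\<beta>}. f (Inl (b j)) = \<delta> j"
      and b_rel: "\<forall>(R, is)\<in>tuples L {1..\<beta>}. (R, map b is) \<in> conf_rel L n f \<longleftrightarrow> is \<in> intp B R"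
      using b(2) unfolding coloured_emb_def by blast+
    let ?Ys = "set (map Yv [\<alpha> + 1..<\<beta> + 1])"
    define h where "h x = (case x of Yv j \<Rightarrow> b j | _ \<Rightarrow> 0)" for x
    define e2 where "e2 x = (if x \<in> ?Ys then h x else e1 x)" for x
    have hr: "h x \<in> {1..n}" if "x \<in> ?Ys" for x
    proof -
      obtain j where j: "x = Yv j" "j \<in> {1..\<beta>}" using \<open>x \<in> ?Ys\<close> by auto
      then have "b j \<in> {1..n}" using b_ran by blast
      then show ?thesis by (simp add: j(1) h_def)
    qed
    have e2r: "e2 x \<in> {1..n}" for x
    proof (cases "x \<in> ?Ys")
      case False
      then have "e2 x = e1 x" by (simp add: e2_def)
      moreover have "e1 x \<in> {1..n}" using e1 by blast
      ultimately show ?thesis by simp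
    qed (use hr in \<open>simp add: e2_def\<close>)
    have e2X: "e2 (Xv i) = e1 (Xv i)" for i by (auto simp: e2_def)
    \<comment> \<open>For j \<le> \<alpha> the variable is not requantified and keeps its old value,
      which \<open>b\<close> extends.\<close>
    have e2Y: "e2 (Yv j) = b j" if "j \<in> {1..\<beta>}" for j
    proof (cases "j \<le> \<alpha>")
      case True
      then show ?thesis using b(1) that by (auto simp: e2_def)
    next
      case False
      then have "Yv j \<in> ?Ys" using that by auto
      then show ?thesis by (simp add: e2_def h_def)
    qed
    have finB: "finite (univ B)" by (simp add: B)
    have "sat ?M e2 (chi L B Yv)"
      unfolding sat_chi_conf[OF fin finB] B
    proof (intro conjI ballI, goal_cases)
      case 1
      have "inj_on (\<lambda>j. e2 (Yv j)) {1..\<beta>} \<longleftrightarrow> inj_on b {1..\<beta>}" by (rule inj_on_cong) (rule e2Y)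
      then show ?case using b_inj by (rule iffD2)
    next
      case (2 x)
      obtain R "is" where x: "x = (R, is)" by (cases x)
      have m: "map (\<lambda>j. e2 (Yv j)) is = map b is"
      proof (rule map_cong[OF refl])
        fix j assume "j \<in> set is"
        then have "j \<in> {1..\<beta>}" using 2 unfolding x tuples_def by blast
        then show "e2 (Yv j) = b j" by (rule e2Y)
      qed
      show ?case unfolding x prod.case m using b_rel 2 x by blast
    qed
    moreover have "sat ?M e2 (theta L S (univ B) \<gamma>' \<tau>)"
      unfolding theta_def B sat_Conj[OF finite_atLeastAtMost]
    proof
      fix j assume j: "j \<in> {1..\<beta>}"
      have "f (Inl (e2 (Xv (\<tau> (\<gamma>' j))))) = f (Inl (e2 (Yv j)))"
      proof -
        have "f (Inl (b j)) = \<delta> j" using b_col j by (rule bspec)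
        then show ?thesis unfolding e2X e2Y[OF j] using j by (simp add: \<delta>_def col_def)
      qed
      moreover have "range e2 \<subseteq> {1..n}" using e2r by blast
      moreover have "Xv (\<tau> (\<gamma>' j)) \<notin> range Wv" "Yv j \<notin> range Wv" by auto
      ultimately show "sat ?M e2 (xi L S (Xv (\<tau> (\<gamma>' j))) (Yv j))"
        using xi by metis
    qed
    ultimately have satQ: "sat ?M e2 (Imp P Q)" unfolding Q_def by simp
    have e2: "(\<lambda>x. if x \<in> ?Ys then h x else e1 x) = e2" by (rule ext) (rule e2_def[symmetric])
    have "\<forall>x\<in>?Ys. h x \<in> univ ?M" unfolding conf_red_sel using hr by (rule ballI)
    moreover have "sat ?M (\<lambda>x. if x \<in> ?Ys then h x else e1 x) (Imp P Q)" unfolding e2 by (rule satQ)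
    ultimately show ?thesis unfolding sat_Exs by (intro exI[of _ h] conjI)
  qed
  have ran: "range (\<lambda>x. if x \<in> V then h x else e x) \<subseteq> {1..n}"
    if "\<forall>x\<in>V. h x \<in> {1..n}" for V and h
  proof (rule image_subsetI)
    fix x
    have "e x \<in> {1..n}" using e by blast
    then show "(if x \<in> V then h x else e x) \<in> {1..n}" using that by (cases "x \<in> V") simp_all
  qed
  show ?thesis
    unfolding inst sat_Alls conf_red_sel by (intro allI impI) (rule main, rule ran)
qed

section \<open>Convergence\<close>

text \<open>With fewer than \<open>l\<close> points the identity is a colouring by
  \<open>l - 1\<close> colours: the colouring \<open>c\<close> shows that each related tuple has two
  distinct entries.\<close>

lemma not_colourable_card_le:
  assumes "is_struct L U" and "univ U = {1..u}" and nc: "\<not> colourable (l - 1) L U"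
    and c: "c \<in> colourings l L U"
  shows "l \<le> u"
proof (rule ccontr)
  assume "\<not> l \<le> u"
  have "restrict id {1..u} \<in> colourings (l - 1) L U"
  proof (rule colouringI)
    show "restrict id {1..u} \<in> univ U \<rightarrow>\<^sub>E {1..l - 1}"
      using \<open>\<not> l \<le> u\<close> assms(2) by auto
  next
    fix R "is" assume R: "R \<in> syms L" "is \<in> intp U R"
    then have sub: "set is \<subseteq> {1..u}" using assms(1) unfolding is_struct_def assms(2) by blast
    obtain i j where ij: "i \<in> set is" "j \<in> set is" "c i \<noteq> c j"
      using nonmono_if_colouring[OF c R] unfolding nonmono_def by blast
    then have "restrict id {1..u} i \<noteq> restrict id {1..u} j"
      using subsetD[OF sub ij(1)] subsetD[OF sub ij(2)] by auto
    then show "nonmono (restrict id {1..u}) is" unfolding nonmono_def using ij(1,2) by (intro bexI)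
  qed
  then show False using nc unfolding colourable_def by blast
qed

lemma finite_colourings: "finite (univ D) \<Longrightarrow> finite (colourings l L D)"
  unfolding colourings_def by (rule finite_subset[of _ "univ D \<rightarrow>\<^sub>E {1..l}"]) (auto intro: finite_PiE)

text \<open>Configurations yield members of \<open>KK\<close>, whose reducts make up
  \<open>CC\<close>, so both membership conditions disappear and the probability is a share of the
  configurations.\<close>

lemma \<delta>C_models_eq:
  fixes L :: "'r lang"
  assumes "finite (syms L)" and "syms L \<noteq> {}" and "\<forall>R\<in>syms L. arity L R \<ge> 2"
  shows "\<delta>C l L n {M \<in> CC l L n. models M \<phi>}
    = real (card {f \<in> configs l L n. models (conf_red L n f) \<phi>}) / real (card (configs l L n))"
proof -
  have "{M \<in> KK l L n. reduct M \<in> {M \<in> CC l L n. models M \<phi>}} = {M \<in> KK l L n. models (reduct M) \<phi>}"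
    unfolding CC_def by blast
  moreover have "{f \<in> configs l L n. conf_struct L n f \<in> {M \<in> KK l L n. models (reduct M) \<phi>}}
      = {f \<in> configs l L n. models (conf_red L n f) \<phi>}"
    using conf_struct_in_KK by blast
  ultimately show ?thesis
    unfolding \<delta>C_def using \<delta>K_eq_card[OF assms, of "{M \<in> KK l L n. models (reduct M) \<phi>}" l n] by simp
qed

theorem corollary9p13:
  fixes l :: nat and L :: "'r lang" and S U :: "('r, nat) struct"
    and c :: "nat \<Rightarrow> nat" and \<phi> :: "('r, var) fm"
  assumes "l \<ge> 2"
    and "finite (syms L)" and "syms L \<noteq> {}" and "\<forall>R\<in>syms L. arity L R \<ge> 2"
    and "same_colour_structure l L S"
    and "balanced_structure l L U"
    and "c \<in> colourings l L U" and "inj_on c {1..l}"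
    and "is_ext_axiom l L S U c \<phi>"
  shows "(\<lambda>n. \<delta>C l L n {M \<in> CC l L n. models M \<phi>}) \<longlonglongrightarrow> 1"
proof -
  note fin = \<open>finite (syms L)\<close>
  obtain s where s: "s \<ge> 3" "univ S = {1..s}"
    using \<open>same_colour_structure l L S\<close> unfolding same_colour_structure_def by blast
  obtain u where u: "univ U = {1..u}" and "is_struct L U" "\<not> colourable (l - 1) L U"
    using \<open>balanced_structure l L U\<close> unfolding balanced_structure_def by blast
  then have lu: "l \<le> u" using not_colourable_card_le \<open>c \<in> colourings l L U\<close> by blast
  obtain A B \<alpha> \<beta> where strB: "is_struct L B" and sub: "proper_substructure A B"
    and uA: "univ A = {1..\<alpha>}" and uB: "univ B = {1..\<beta>}" and \<phi>: "\<phi> = ext_axiom l L S U c A B"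
    using \<open>is_ext_axiom l L S U c \<phi>\<close> unfolding is_ext_axiom_def by blast
  have AB: "{1..\<alpha>} \<subset> {1..\<beta>}" and A: "A = substr B {1..\<alpha>}"
    using sub unfolding proper_substructure_def uA uB by blast+
  have \<alpha>: "\<alpha> < \<beta>" using psubset_card_mono[OF _ AB] by simp
  \<comment> \<open>As \<open>s \<ge> 3\<close>, the point 1 of \<open>S\<close> is neither
    \<open>s - 1\<close> nor \<open>s\<close>; with a new point to find, the extension bound
    applies.\<close>
  have sS: "{s - 1, s} \<subset> univ S"
  proof -
    have "1 \<in> univ S" "1 \<notin> {s - 1, s}" "{s - 1, s} \<subseteq> univ S" using s by auto
    then show ?thesis by blast
  qed
  define bad where "bad D \<gamma> X n = {f \<in> configs l L n. \<not> all_extend L D \<gamma> X n f}" for D \<gamma> X n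
  define good where "good n = {f \<in> configs l L n. models (conf_red L n f) \<phi>}" for n
  let ?N = "\<lambda>n. real (card (configs l L n))"
  \<comment> \<open>A union bound over the colourings of \<open>S\<close> and \<open>B\<close>;
    their numbers do not depend on \<open>n\<close>, so the sum still tends to 0.\<close>
  define err where "err n = (\<Sum>\<gamma>\<in>colourings l L S. real (card (bad S \<gamma> {s - 1, s} n)) / ?N n)
      + (\<Sum>\<gamma>\<in>colourings l L B. real (card (bad B \<gamma> {1..\<alpha>} n)) / ?N n)" for n
  have finS: "finite (univ S)" and finB: "finite (univ B)" by (simp_all add: s uB)
  have "err \<longlonglongrightarrow> 0 + 0"
    unfolding err_def bad_def
    using tendsto_not_all_extend[OF fin \<open>l \<ge> 2\<close> finS sS] tendsto_not_all_extend[OF fin \<open>l \<ge> 2\<close> finB AB[folded uB]]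
    by (intro tendsto_add tendsto_null_sum)
  then have lim: "(\<lambda>n. 1 - err n) \<longlonglongrightarrow> 1"
    using tendsto_diff[OF tendsto_const[of 1]] by fastforce
  have N0: "?N n > 0" for n using \<open>l \<ge> 2\<close> by (simp add: card_configs[OF fin])
  have finC: "finite (configs l L n)" for n using fin by (rule finite_configs)
  have colS: "finite (colourings l L S)" and colB: "finite (colourings l L B)"
    using finS finB by (simp_all add: finite_colourings)
  \<comment> \<open>Outside the bad events \<open>xi\<close> defines equality of colours and
    coloured embeddings of \<open>A\<close> extend to \<open>B\<close>, so all instances of the
    axiom hold.\<close>
  have cover: "configs l L n \<subseteq> good n \<union> ((\<Union>\<gamma>\<in>colourings l L S. bad S \<gamma> {s - 1, s} n)
      \<union> (\<Union>\<gamma>\<in>colourings l L B. bad B \<gamma> {1..\<alpha>} n))" for n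
  proof
    fix f assume f: "f \<in> configs l L n"
    show "f \<in> good n \<union> ((\<Union>\<gamma>\<in>colourings l L S. bad S \<gamma> {s - 1, s} n)
      \<union> (\<Union>\<gamma>\<in>colourings l L B. bad B \<gamma> {1..\<alpha>} n))"
    proof (rule ccontr)
      assume *: "f \<notin> good n \<union> ((\<Union>\<gamma>\<in>colourings l L S. bad S \<gamma> {s - 1, s} n)
        \<union> (\<Union>\<gamma>\<in>colourings l L B. bad B \<gamma> {1..\<alpha>} n))"
      then have extS: "all_extend L S \<gamma> {s - 1, s} n f" if "\<gamma> \<in> colourings l L S" for \<gamma>
        using that f unfolding bad_def by blast
      from * have extB: "all_extend L B \<gamma> {1..\<alpha>} n f" if "\<gamma> \<in> colourings l L B" for \<gamma>
        using that f unfolding bad_def by blast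
      have finI: "finite (colourings l L B \<times> {\<tau>. \<tau> permutes {1..l}})"
        using colB by (simp add: finite_permutations)
      have "models (conf_red L n f) \<phi>"
        unfolding models_def \<phi> ext_axiom_def sat_Conj[OF finI] conf_red_sel
      proof (intro allI impI ballI, clarify)
        fix e :: "var \<Rightarrow> nat" and \<gamma>' \<tau>
        assume e: "range e \<subseteq> {1..n}" and "\<gamma>' \<in> colourings l L B" "\<tau> permutes {1..l}"
        then show "sat (conf_red L n f) e (ext_instance L S U c A B \<gamma>' \<tau>)"
          using sat_ext_instance[OF fin \<open>same_colour_structure l L S\<close> s(2) u lu \<open>inj_on c {1..l}\<close>
            A uB \<alpha> strB _ _ f extS extB e] by blast
      qed
      then show False using * f unfolding good_def by blast
    qed
  qed
  have le: "1 - err n \<le> real (card (good n)) / ?N n" for n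
  proof -
    let ?BS = "\<Union>\<gamma>\<in>colourings l L S. bad S \<gamma> {s - 1, s} n"
    let ?BB = "\<Union>\<gamma>\<in>colourings l L B. bad B \<gamma> {1..\<alpha>} n"
    have fb: "finite (bad D \<gamma> X n)" for D \<gamma> X unfolding bad_def using finC by simp
    have fg: "finite (good n)" unfolding good_def using finC by simp
    have "card (configs l L n) \<le> card (good n \<union> (?BS \<union> ?BB))"
      by (rule card_mono[OF _ cover]) (use fg fb colS colB in simp)
    also have "\<dots> \<le> card (good n) + (card ?BS + card ?BB)"
      by (meson card_Un_le add_left_mono order.trans)
    also have "\<dots> \<le> card (good n) + ((\<Sum>\<gamma>\<in>colourings l L S. card (bad S \<gamma> {s - 1, s} n))
        + (\<Sum>\<gamma>\<in>colourings l L B. card (bad B \<gamma> {1..\<alpha>} n)))"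
      using colS colB by (intro add_left_mono add_mono card_UN_le)
    finally have "?N n \<le> real (card (good n) + ((\<Sum>\<gamma>\<in>colourings l L S. card (bad S \<gamma> {s - 1, s} n))
        + (\<Sum>\<gamma>\<in>colourings l L B. card (bad B \<gamma> {1..\<alpha>} n))))"
      by (simp only: of_nat_le_iff)
    also have "\<dots> = real (card (good n)) + err n * ?N n"
      using N0[of n] by (simp add: err_def sum_divide_distrib[symmetric] field_simps)
    finally show ?thesis using N0[of n] by (simp add: field_simps)
  qed
  have ge: "real (card (good n)) / ?N n \<le> 1" for n
    using N0[of n] card_mono[OF finC[of n], of "good n"] by (auto simp: good_def divide_le_eq_1)
  have "(\<lambda>n. real (card (good n)) / ?N n) \<longlonglongrightarrow> 1"
    by (rule tendsto_sandwich[OF _ _ lim tendsto_const]) (use le ge in simp_all)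
  then show ?thesis unfolding good_def by (simp add: \<delta>C_models_eq[OF assms(2,3,4)])
qed

end
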